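(* Let $q\ge 2$ be an integer. (1) $\mathrm{Square}(q)$ is homotopy equivalent to a bouquet of spheres, and for every $j\ge0$, $\dim\bar H_j(\mathrm{Square}(q),\mathbb{Q})$ equals the number of ways to write $q-1$ as a sum of $j+1$ distinct positive integer squares $>1$. Consequently, for $q\ge 3$: $\mathrm{Square}(q)$ is connected if and only if $q-1$ is not a positive integer square; and $\mathrm{Square}(q)$ is simply connected if and only if $q-1$ is neither a positive integer square nor the sum of two distinct positive integer squares $>1$. (2) For every $j\ge 0$, $\dim\bar H_j(\mathrm{Cube}(q),\mathbb{Q})$ equals the number of ways to write $q-1$ as a sum of $j+1$ distinct positive integer cubes $>1$.
   Context: $\mathrm{Square}(q)$ (respectively $\mathrm{Cube}(q)$) is the simplicial complex whose faces are the nonempty finite sets of distinct positive integer squares $1,4,9,\dots$ (respectively positive integer cubes $1,8,27,\dots$) whose sum is less than $q$; a set of $j+1$ elements is a $j$-dimensional face. A bouquet of spheres is a wedge of a (possibly empty) collection of spheres, not necessarily of the same dimension, with $0$-spheres allowed; the empty bouquet is a point. $\bar H_j$ denotes reduced homology. Ways of writing a number as a sum are unordered, i.e. are sets of $j+1$ distinct squares (cubes) with the given sum. Simply connected means path connected with trivial fundamental group. *)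

theory Defs
  imports "HOL-Analysis.Analysis" "HOL-Algebra.Elementary_Groups" "Jordan_Normal_Form.Missing_VectorSpace"
begin

section \<open>The complexes\<close>

definition pos_powers :: "nat \<Rightarrow> nat set" where
  "pos_powers k = {n ^ k | n. n > 0}"

abbreviation pos_squares :: "nat set" where "pos_squares \<equiv> pos_powers 2"
abbreviation pos_cubes :: "nat set" where "pos_cubes \<equiv> pos_powers 3"

text \<open>Abstract simplicial complexes are given by their sets of nonempty faces.\<close>

definition bounded_sum_complex :: "nat set \<Rightarrow> nat \<Rightarrow> nat set set" where
  "bounded_sum_complex A q = {F. finite F \<and> F \<noteq> {} \<and> F \<subseteq> A \<and> \<Sum>F < q}"

definition Square :: "nat \<Rightarrow> nat set set" where
  "Square q = bounded_sum_complex pos_squares q"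

definition Cube :: "nat \<Rightarrow> nat set set" where
  "Cube q = bounded_sum_complex pos_cubes q"

definition distinct_sum_reps :: "nat set \<Rightarrow> nat \<Rightarrow> nat \<Rightarrow> nat set set" where
  "distinct_sum_reps A m N = {S. finite S \<and> S \<subseteq> A \<and> card S = m \<and> \<Sum>S = N}"

section \<open>Geometric realization\<close>

text \<open>Barycentric coordinates. The topology used is the product topology on functions, which is
  the usual (coherent) topology of the realization when the complex is finite, as it is here.\<close>

definition geom_realization :: "'a set set \<Rightarrow> ('a \<Rightarrow> real) set" where
  "geom_realization K =
    {x. (\<forall>v. x v \<ge> 0) \<and> {v. x v \<noteq> 0} \<in> K \<and> (\<Sum>v | x v \<noteq> 0. x v) = 1}"

section \<open>Bouquets of spheres\<close>

text \<open>In the wedge of the pointed spaces \<^term>\<open>(X i, p i)\<close>, the common base point is \<^term>\<open>None\<close>; a set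
  is open iff its preimage in every \<^term>\<open>X i\<close> is. For the empty family the wedge is a point.\<close>

definition wedge_incl :: "('i \<Rightarrow> 'b) \<Rightarrow> 'i \<Rightarrow> 'b \<Rightarrow> ('i \<times> 'b) option" where
  "wedge_incl p i x = (if x = p i then None else Some (i, x))"

definition wedge_points :: "'i set \<Rightarrow> ('i \<Rightarrow> 'b topology) \<Rightarrow> ('i \<Rightarrow> 'b) \<Rightarrow> ('i \<times> 'b) option set" where
  "wedge_points I X p = insert None (\<Union>i\<in>I. wedge_incl p i ` topspace (X i))"

definition wedge :: "'i set \<Rightarrow> ('i \<Rightarrow> 'b topology) \<Rightarrow> ('i \<Rightarrow> 'b) \<Rightarrow> ('i \<times> 'b) option topology" where
  "wedge I X p = topology (\<lambda>U. U \<subseteq> wedge_points I X p \<and>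
     (\<forall>i\<in>I. openin (X i) {x \<in> topspace (X i). wedge_incl p i x \<in> U}))"

lemma openin_wedge:
  "openin (wedge I X p) U \<longleftrightarrow> U \<subseteq> wedge_points I X p \<and>
     (\<forall>i\<in>I. openin (X i) {x \<in> topspace (X i). wedge_incl p i x \<in> U})"
proof -
  have "istopology (\<lambda>U. U \<subseteq> wedge_points I X p \<and>
     (\<forall>i\<in>I. openin (X i) {x \<in> topspace (X i). wedge_incl p i x \<in> U}))"
    unfolding istopology_def
  proof (intro conjI allI impI ballI; (elim conjE)?)
    fix S T i
    assume "i \<in> I"
      and "\<forall>i\<in>I. openin (X i) {x \<in> topspace (X i). wedge_incl p i x \<in> S}"
      and "\<forall>i\<in>I. openin (X i) {x \<in> topspace (X i). wedge_incl p i x \<in> T}"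
    then have "openin (X i) ({x \<in> topspace (X i). wedge_incl p i x \<in> S} \<inter>
        {x \<in> topspace (X i). wedge_incl p i x \<in> T})"
      by blast
    also have "{x \<in> topspace (X i). wedge_incl p i x \<in> S} \<inter>
        {x \<in> topspace (X i). wedge_incl p i x \<in> T} =
        {x \<in> topspace (X i). wedge_incl p i x \<in> S \<inter> T}"
      by auto
    finally show "openin (X i) {x \<in> topspace (X i). wedge_incl p i x \<in> S \<inter> T}" .
  next
    fix \<K> i
    assume "i \<in> I" and K: "\<forall>K\<in>\<K>. K \<subseteq> wedge_points I X p \<and>
       (\<forall>i\<in>I. openin (X i) {x \<in> topspace (X i). wedge_incl p i x \<in> K})"
    then have "openin (X i) (\<Union>K\<in>\<K>. {x \<in> topspace (X i). wedge_incl p i x \<in> K})"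
      by blast
    also have "(\<Union>K\<in>\<K>. {x \<in> topspace (X i). wedge_incl p i x \<in> K}) =
        {x \<in> topspace (X i). wedge_incl p i x \<in> \<Union>\<K>}"
      by auto
    finally show "openin (X i) {x \<in> topspace (X i). wedge_incl p i x \<in> \<Union>\<K>}" .
  qed auto
  then show ?thesis
    by (simp add: wedge_def)
qed

lemma topspace_wedge: "topspace (wedge I X p) = wedge_points I X p"
proof -
  have "{x \<in> topspace (X i). wedge_incl p i x \<in> wedge_points I X p} = topspace (X i)" if "i \<in> I" for i
    using that by (auto simp: wedge_points_def)
  then have "openin (wedge I X p) (wedge_points I X p)"
    by (simp add: openin_wedge)
  then show ?thesis
    by (meson openin_subset openin_topspace openin_wedge subset_antisym)
qed

definition sphere_basepoint :: "nat \<Rightarrow> real" where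
  "sphere_basepoint = (\<lambda>k. if k = 0 then 1 else 0)"

lemma sphere_basepoint: "sphere_basepoint \<in> topspace (nsphere n)"
proof -
  have "(\<Sum>i\<le>n. (sphere_basepoint i)\<^sup>2) = (\<Sum>i\<le>n. if i = 0 then 1 else 0)"
    by (intro sum.cong) (auto simp: sphere_basepoint_def)
  then show ?thesis
    by (simp add: nsphere sphere_basepoint_def)
qed

text \<open>The bouquet with one sphere of dimension \<^term>\<open>d i\<close> for each index \<^term>\<open>i \<in> I\<close>.\<close>

definition sphere_bouquet :: "'i set \<Rightarrow> ('i \<Rightarrow> nat) \<Rightarrow> ('i \<times> (nat \<Rightarrow> real)) option topology" where
  "sphere_bouquet I d = wedge I (\<lambda>i. nsphere (d i)) (\<lambda>i. sphere_basepoint)"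

section \<open>Simple connectedness\<close>

definition based_loops :: "'a::topological_space set \<Rightarrow> 'a \<Rightarrow> (real \<Rightarrow> 'a) set" where
  "based_loops S a = {p. path p \<and> path_image p \<subseteq> S \<and> pathstart p = a \<and> pathfinish p = a}"

definition loop_class :: "'a::topological_space set \<Rightarrow> 'a \<Rightarrow> (real \<Rightarrow> 'a) \<Rightarrow> (real \<Rightarrow> 'a) set" where
  "loop_class S a p = {q \<in> based_loops S a. homotopic_paths S p q}"

definition fundamental_group ::
    "'a::topological_space set \<Rightarrow> 'a \<Rightarrow> (real \<Rightarrow> 'a) set monoid" where
  "fundamental_group S a =
    \<lparr>carrier = loop_class S a ` based_loops S a,
     mult = (\<lambda>P Q. \<Union>p\<in>P. \<Union>q\<in>Q. loop_class S a (p +++ q)),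
     one = loop_class S a (\<lambda>t. a)\<rparr>"

text \<open>The library's \<^const>\<open>simply_connected\<close> is phrased with free homotopies of loops; here the definition
  by path connectedness and the fundamental group is used.\<close>

definition simply_conn :: "'a::topological_space set \<Rightarrow> bool" where
  "simply_conn S \<longleftrightarrow> path_connected S \<and> (\<forall>a\<in>S. trivial_group (fundamental_group S a))"

lemma trivial_fundamental_group_iff:
  assumes a: "a \<in> S"
  shows "trivial_group (fundamental_group S a) \<longleftrightarrow>
    (\<forall>p\<in>based_loops S a. homotopic_paths S p (\<lambda>t. a))"
proof
  have const: "(\<lambda>t. a) \<in> based_loops S a"
    using a by (auto simp: based_loops_def path_def path_image_def pathstart_def pathfinish_def)
  have self: "p \<in> loop_class S a p" if "p \<in> based_loops S a" for p
    using that by (auto simp: loop_class_def based_loops_def)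
  {
    assume "trivial_group (fundamental_group S a)"
    then have *: "loop_class S a ` based_loops S a = {loop_class S a (\<lambda>t. a)}"
      by (simp add: trivial_group_def fundamental_group_def)
    show "\<forall>p\<in>based_loops S a. homotopic_paths S p (\<lambda>t. a)"
    proof
      fix p assume p: "p \<in> based_loops S a"
      then have "loop_class S a p = loop_class S a (\<lambda>t. a)"
        using * by blast
      then have "(\<lambda>t. a) \<in> loop_class S a p"
        using self[OF const] by simp
      then show "homotopic_paths S p (\<lambda>t. a)"
        by (simp add: loop_class_def)
    qed
  next
    assume h: "\<forall>p\<in>based_loops S a. homotopic_paths S p (\<lambda>t. a)"
    have cls: "loop_class S a p = based_loops S a" if "p \<in> based_loops S a" for p
      using that h unfolding loop_class_def
      by (auto intro: homotopic_paths_trans homotopic_paths_sym)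
    have join: "p +++ q \<in> based_loops S a" if "p \<in> based_loops S a" "q \<in> based_loops S a" for p q
      using that by (auto simp: based_loops_def path_image_join)
    have car: "carrier (fundamental_group S a) = {based_loops S a}"
      and one: "one (fundamental_group S a) = based_loops S a"
      using cls const by (auto simp: fundamental_group_def)
    have mult: "mult (fundamental_group S a) (based_loops S a) (based_loops S a) = based_loops S a"
      using cls join const by (auto simp: fundamental_group_def)
    show "trivial_group (fundamental_group S a)"
      unfolding trivial_group_def
      by (intro conjI groupI) (auto simp: car one mult)
  }
qed

section \<open>Reduced rational homology of a simplicial complex\<close>

text \<open>Rational chains on the faces with \<^term>\<open>m\<close> elements, i.e. of dimension \<^term>\<open>m - 1\<close>; the empty face
  (\<^term>\<open>m = 0\<close>) is included, which makes the homology reduced. The chain \<^term>\<open>c\<close> stands for the formal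
  sum of the faces \<^term>\<open>F\<close>, with increasingly ordered vertices, with coefficients \<^term>\<open>c F\<close>.\<close>

definition chains :: "'a set set \<Rightarrow> nat \<Rightarrow> ('a set \<Rightarrow> rat) set" where
  "chains K m = {c. finite {F. c F \<noteq> 0} \<and> (\<forall>F. c F \<noteq> 0 \<longrightarrow> F \<in> insert {} K \<and> finite F \<and> card F = m)}"

text \<open>The coefficient at \<^term>\<open>G\<close> of the usual alternating boundary: \<^term>\<open>G\<close> arises from
  \<^term>\<open>insert v G\<close> by deleting \<^term>\<open>v\<close>, whose position (from 0) in \<^term>\<open>insert v G\<close> is the number of
  elements of \<^term>\<open>G\<close> below \<^term>\<open>v\<close>.\<close>

definition bdry :: "('a::linorder set \<Rightarrow> rat) \<Rightarrow> 'a set \<Rightarrow> rat" where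
  "bdry c G = (\<Sum>v | v \<notin> G \<and> c (insert v G) \<noteq> 0. (-1) ^ card {u \<in> G. u < v} * c (insert v G))"

definition cycles :: "'a::linorder set set \<Rightarrow> nat \<Rightarrow> ('a set \<Rightarrow> rat) set" where
  "cycles K m = {c \<in> chains K m. bdry c = (\<lambda>G. 0)}"

definition boundaries :: "'a::linorder set set \<Rightarrow> nat \<Rightarrow> ('a set \<Rightarrow> rat) set" where
  "boundaries K m = bdry ` chains K (Suc m)"

definition rat_field :: "rat ring" where
  "rat_field = \<lparr>carrier = UNIV, mult = (*), one = 1, zero = 0, add = (+)\<rparr>"

text \<open>The quotient of the space \<^term>\<open>Z\<close> of rational functions by its subspace \<^term>\<open>B\<close>. The fields
  \<^const>\<open>mult\<close> and \<^const>\<open>one\<close> are present in every \<open>module\<close> record but carry no meaning.\<close>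

definition quotient_space :: "('b \<Rightarrow> rat) set \<Rightarrow> ('b \<Rightarrow> rat) set \<Rightarrow> (rat, ('b \<Rightarrow> rat) set) module" where
  "quotient_space Z B =
    \<lparr>carrier = (\<lambda>z. {\<lambda>x. z x + b x | b. b \<in> B}) ` Z,
     mult = undefined, one = undefined,
     zero = B,
     add = (\<lambda>P Q. {\<lambda>x. p x + q x | p q. p \<in> P \<and> q \<in> Q}),
     smult = (\<lambda>r P. {\<lambda>x. r * p x + b x | p b. p \<in> P \<and> b \<in> B})\<rparr>"

lemma field_rat_field: "field rat_field"
proof -
  have "\<exists>y. y + x = 0" for x :: rat
    by (metis add.left_inverse)
  moreover have inv: "\<exists>y. x * y = 1" if "x \<noteq> 0" for x :: rat
    using that by (metis right_inverse)
  ultimately have "cring rat_field"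
    by (intro cringI abelian_groupI comm_monoidI) (auto simp: rat_field_def algebra_simps)
  then show ?thesis
    by (rule cring.cring_fieldI2) (auto simp: rat_field_def inv)
qed

definition rat_subspace :: "('b \<Rightarrow> rat) set \<Rightarrow> bool" where
  "rat_subspace Z \<longleftrightarrow> (\<lambda>x. 0) \<in> Z \<and> (\<forall>f\<in>Z. \<forall>g\<in>Z. (\<lambda>x. f x + g x) \<in> Z) \<and>
     (\<forall>r. \<forall>f\<in>Z. (\<lambda>x. r * f x) \<in> Z)"

lemma vectorspace_quotient_space:
  assumes Z: "rat_subspace Z" and B: "rat_subspace B"
  shows "vectorspace rat_field (quotient_space Z B)"
proof -
  define cs where "cs z = {\<lambda>x. z x + b x | b. b \<in> B}" for z :: "'a \<Rightarrow> rat"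
  let ?V = "quotient_space Z B"
  have Bz: "(\<lambda>x. 0) \<in> B" and Ba: "\<And>f g. f \<in> B \<Longrightarrow> g \<in> B \<Longrightarrow> (\<lambda>x. f x + g x) \<in> B"
    and Bs: "\<And>r f. f \<in> B \<Longrightarrow> (\<lambda>x. r * f x) \<in> B"
    using B by (auto simp: rat_subspace_def)
  have Zz: "(\<lambda>x. 0) \<in> Z" and Za: "\<And>f g. f \<in> Z \<Longrightarrow> g \<in> Z \<Longrightarrow> (\<lambda>x. f x + g x) \<in> Z"
    and Zs: "\<And>r f. f \<in> Z \<Longrightarrow> (\<lambda>x. r * f x) \<in> Z"
    using Z by (auto simp: rat_subspace_def)
  have car: "carrier ?V = cs ` Z"
    by (auto simp: quotient_space_def cs_def)
  have zero: "zero ?V = cs (\<lambda>x. 0)"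
    by (auto simp: quotient_space_def cs_def)
  have add: "add ?V (cs f) (cs g) = cs (\<lambda>x. f x + g x)" for f g
  proof -
    have "add ?V (cs f) (cs g) = {\<lambda>x. (f x + a x) + (g x + b x) | a b. a \<in> B \<and> b \<in> B}"
      by (fastforce simp: quotient_space_def cs_def)
    also have "\<dots> = cs (\<lambda>x. f x + g x)"
    proof (intro equalityI subsetI)
      fix h assume "h \<in> {\<lambda>x. (f x + a x) + (g x + b x) | a b. a \<in> B \<and> b \<in> B}"
      then obtain a b where ab: "a \<in> B" "b \<in> B" and h: "h = (\<lambda>x. (f x + a x) + (g x + b x))"
        by auto
      have "h = (\<lambda>x. (f x + g x) + (a x + b x))"
        by (simp add: h algebra_simps)
      then show "h \<in> cs (\<lambda>x. f x + g x)"
        using Ba[OF ab] unfolding cs_def mem_Collect_eq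
        by (intro exI[of _ "\<lambda>x. a x + b x"]) simp
    next
      fix h assume "h \<in> cs (\<lambda>x. f x + g x)"
      then obtain a where "a \<in> B" "h = (\<lambda>x. (f x + g x) + a x)"
        by (auto simp: cs_def)
      then show "h \<in> {\<lambda>x. (f x + a x) + (g x + b x) | a b. a \<in> B \<and> b \<in> B}"
        using Bz unfolding mem_Collect_eq
        by (intro exI[of _ a] exI[of _ "\<lambda>x. 0"]) (auto simp: algebra_simps)
    qed
    finally show ?thesis .
  qed
  have smult: "smult ?V r (cs f) = cs (\<lambda>x. r * f x)" for r f
  proof (intro equalityI subsetI)
    fix h assume "h \<in> smult ?V r (cs f)"
    then obtain a b where ab: "a \<in> B" "b \<in> B" and h: "h = (\<lambda>x. r * (f x + a x) + b x)"
      by (auto simp: quotient_space_def cs_def)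
    have "h = (\<lambda>x. r * f x + (r * a x + b x))"
      by (simp add: h algebra_simps)
    then show "h \<in> cs (\<lambda>x. r * f x)"
      using Ba[OF Bs[OF ab(1), of r] ab(2)] unfolding cs_def mem_Collect_eq
      by (intro exI[of _ "\<lambda>x. r * a x + b x"]) simp
  next
    fix h assume "h \<in> cs (\<lambda>x. r * f x)"
    then obtain b where b: "b \<in> B" "h = (\<lambda>x. r * f x + b x)"
      by (auto simp: cs_def)
    moreover have "f \<in> cs f"
      using Bz unfolding cs_def mem_Collect_eq by (intro exI[of _ "\<lambda>x. 0"]) simp
    ultimately show "h \<in> smult ?V r (cs f)"
      by (auto simp: quotient_space_def)
  qed
  interpret F: field rat_field by (rule field_rat_field)
  have "abelian_group ?V"
  proof (rule abelian_groupI)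
    fix P assume "P \<in> carrier ?V"
    then obtain f where f: "f \<in> Z" "P = cs f" by (auto simp: car)
    have "add ?V (cs (\<lambda>x. - 1 * f x)) P = zero ?V"
      by (simp add: f add zero)
    then show "\<exists>Q\<in>carrier ?V. add ?V Q P = zero ?V"
      using Zs[OF f(1), of "-1"] by (auto simp: car)
  qed (auto simp: car zero add Zz Za algebra_simps)
  moreover have "module rat_field ?V"
  proof (rule moduleI)
    show "cring rat_field" by (rule F.is_cring)
  qed (use calculation in \<open>auto simp: car smult add Zs rat_field_def algebra_simps\<close>)
  ultimately show ?thesis
    by (intro vectorspace.intro field_rat_field)
qed

definition reduced_homology ::
    "'a::linorder set set \<Rightarrow> nat \<Rightarrow> (rat, ('a set \<Rightarrow> rat) set) module" where
  "reduced_homology K j = quotient_space (cycles K (Suc j)) (boundaries K (Suc j))"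

lemma bdry_eq:
  assumes "finite V" "{v. v \<notin> G \<and> c (insert v G) \<noteq> 0} \<subseteq> V"
  shows "bdry c G = (\<Sum>v | v \<in> V \<and> v \<notin> G. (-1) ^ card {u \<in> G. u < v} * c (insert v G))"
  unfolding bdry_def using assms by (intro sum.mono_neutral_left) auto

lemma finite_bdry_support:
  assumes "c \<in> chains K m"
  shows "finite {v. v \<notin> G \<and> c (insert v G) \<noteq> 0}"
proof (rule finite_imageD)
  show "finite ((\<lambda>v. insert v G) ` {v. v \<notin> G \<and> c (insert v G) \<noteq> 0})"
    by (rule finite_subset[of _ "{F. c F \<noteq> 0}"]) (use assms in \<open>auto simp: chains_def\<close>)
  show "inj_on (\<lambda>v. insert v G) {v. v \<notin> G \<and> c (insert v G) \<noteq> 0}"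
    by (auto simp: inj_on_def)
qed

lemma bdry_add:
  assumes "c \<in> chains K m" "d \<in> chains K m"
  shows "bdry (\<lambda>F. c F + d F) = (\<lambda>G. bdry c G + bdry d G)"
proof
  fix G
  let ?V = "{v. v \<notin> G \<and> c (insert v G) \<noteq> 0} \<union> {v. v \<notin> G \<and> d (insert v G) \<noteq> 0}"
  have V: "finite ?V"
    using assms by (simp add: finite_bdry_support)
  show "bdry (\<lambda>F. c F + d F) G = bdry c G + bdry d G"
    by (subst (1 2 3) bdry_eq[OF V]) (auto simp: sum.distrib algebra_simps)
qed

lemma bdry_scale: "bdry (\<lambda>F. r * c F) = (\<lambda>G. r * bdry c G)"
proof (cases "r = 0")
  case True
  then show ?thesis by (simp add: bdry_def fun_eq_iff)
next
  case False
  then show ?thesis by (simp add: bdry_def fun_eq_iff sum_distrib_left algebra_simps)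
qed

lemma rat_subspace_chains: "rat_subspace (chains K m)"
proof -
  have fin: "finite {F. f F + g F \<noteq> 0}" if "finite {F. f F \<noteq> 0}" "finite {F. g F \<noteq> 0}"
    for f g :: "'a set \<Rightarrow> rat"
    by (rule finite_subset[OF _ finite_UnI[OF that]]) auto
  have fin': "finite {F. r * f F \<noteq> 0}" if "finite {F. f F \<noteq> 0}" for r and f :: "'a set \<Rightarrow> rat"
    by (rule finite_subset[OF _ that]) auto
  have nz: "f F \<noteq> 0 \<or> g F \<noteq> 0" if "f F + g F \<noteq> 0" for F and f g :: "'a set \<Rightarrow> rat"
    using that by auto
  show ?thesis
    unfolding rat_subspace_def
  proof (intro conjI ballI allI)
    fix f g assume "f \<in> chains K m" "g \<in> chains K m"
    then show "(\<lambda>x. f x + g x) \<in> chains K m"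
      unfolding chains_def mem_Collect_eq by (blast intro: fin dest: nz)
  next
    fix r f assume "f \<in> chains K m"
    then show "(\<lambda>x. r * f x) \<in> chains K m"
      unfolding chains_def mem_Collect_eq by (intro conjI fin') auto
  qed (auto simp: chains_def)
qed

lemma vectorspace_reduced_homology: "vectorspace rat_field (reduced_homology K j)"
proof -
  have C: "(\<lambda>x. 0) \<in> chains K m" "\<And>f g. f \<in> chains K m \<Longrightarrow> g \<in> chains K m \<Longrightarrow> (\<lambda>x. f x + g x) \<in> chains K m"
    "\<And>r f. f \<in> chains K m \<Longrightarrow> (\<lambda>x. r * f x) \<in> chains K m" for m
    using rat_subspace_chains[of K m] by (auto simp: rat_subspace_def)
  have "rat_subspace (cycles K m)" for m
    using C unfolding rat_subspace_def cycles_def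
    by (auto simp: bdry_scale bdry_add) (simp add: bdry_def fun_eq_iff)
  moreover have "rat_subspace (boundaries K m)" for m
    unfolding rat_subspace_def boundaries_def
  proof (intro conjI ballI allI)
    have "bdry (\<lambda>F. 0) = (\<lambda>G::'a set. 0)"
      by (simp add: bdry_def fun_eq_iff)
    then show "(\<lambda>x. 0) \<in> bdry ` chains K (Suc m)"
      using C(1) by (metis imageI)
  next
    fix f g assume "f \<in> bdry ` chains K (Suc m)" "g \<in> bdry ` chains K (Suc m)"
    then show "(\<lambda>x. f x + g x) \<in> bdry ` chains K (Suc m)"
      using C(2) by (auto simp: bdry_add[symmetric])
  next
    fix r f assume "f \<in> bdry ` chains K (Suc m)"
    then show "(\<lambda>x. r * f x) \<in> bdry ` chains K (Suc m)"
      using C(3) by (auto simp: bdry_scale[symmetric])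
  qed
  ultimately show ?thesis
    unfolding reduced_homology_def by (intro vectorspace_quotient_space)
qed

definition dim_reduced_homology :: "'a::linorder set set \<Rightarrow> nat \<Rightarrow> nat" where
  "dim_reduced_homology K j = vectorspace.dim rat_field (reduced_homology K j)"

end

theory Submission
  imports Defs "Jordan_Normal_Form.VS_Connect" "HOL-Complex_Analysis.Winding_Numbers"
begin

text \<open>If \<open>F\<close> is a face and \<open>insert 1 F\<close> is not, then \<open>1 \<notin> F\<close> and the elements of \<open>F\<close> sum to \<open>q - 1\<close>;
  conversely, the other elements being at least \<open>2\<close>, every proper subset of such an \<open>F\<close> is still
  a face after adding \<open>1\<close>. So the complex is a cone with apex \<open>1\<close> to which the simplices \<open>F\<close> are
  attached along their boundaries. Contracting the cone turns it into a bouquet with one sphere of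
  dimension \<open>card F - 1\<close> for each \<open>F\<close>. On the algebraic side, a cycle is determined modulo boundaries
  by its coefficients at the faces \<open>F\<close>: if they vanish, the cycle is the boundary of its cone.

  A loop in the realization is homotopic to one that runs through vertices. If all \<open>F\<close> have at
  least three elements, the triangles with vertex \<open>1\<close> contract such a loop; if some \<open>F\<close> is an
  edge, then wrapping it around the circle detects a loop with winding number \<open>1\<close>.\<close>

section \<open>Simplicial chains and cones\<close>

text \<open>Squares and cubes enter only through \<open>1 \<in> A\<close> and
  \<open>0 \<notin> A\<close>. The rest takes place in the locale \<open>cone_with_facets\<close>,
  which has neither numbers nor an order; an order with least apex matters only for the signs of the
  boundary operator. In place of the homotopy extension property, one explicit deformation
  \<open>deflate\<close> of the whole realization keeps the part to be crushed inside itself at all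
  times, so that it descends to the quotient. The obstacle is that a facet together with the apex is
  not a face: an interior point of a facet may not move towards the apex while all its coordinates
  are positive. That the quotient is a bouquet follows from compactness: continuous surjections from
  the realization onto spheres are quotient maps, and these are assembled into one map onto the
  wedge. Connectedness and simple connectedness are not transported from the bouquet but proved in
  the realization, where paths can be followed through closed simplices.\<close>

lemma bdry_nonzeroE:
  assumes "bdry c G \<noteq> 0"
  obtains v where "v \<notin> G" "c (insert v G) \<noteq> 0"
proof -
  have "{v. v \<notin> G \<and> c (insert v G) \<noteq> 0} \<noteq> {}"
    using assms unfolding bdry_def by (intro notI) (simp only: sum.empty)
  then show ?thesis using that by blast
qed

lemma sum_antisym_pairs_eq_0:
  fixes h :: "'b \<Rightarrow> 'b \<Rightarrow> rat"
  assumes "\<And>v w. v \<in> V \<Longrightarrow> w \<in> V \<Longrightarrow> h v w = - h w v"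
  shows "(\<Sum>v\<in>V. \<Sum>w\<in>V. h v w) = 0"
proof -
  have "(\<Sum>v\<in>V. \<Sum>w\<in>V. h v w) = (\<Sum>v\<in>V. \<Sum>w\<in>V. h w v)"
    by (rule sum.swap)
  also have "\<dots> = - (\<Sum>v\<in>V. \<Sum>w\<in>V. h v w)"
    unfolding sum_negf[symmetric] by (intro sum.cong refl) (rule assms)
  finally show ?thesis by simp
qed

text \<open>Two vertices can be deleted in two orders. Deleting the smaller one first lowers the
  position of the larger one by 1, while the other order shifts nothing, so the two contributions
  have opposite signs.\<close>

lemma bdry_bdry:
  fixes c :: "'a::linorder set \<Rightarrow> rat"
  assumes fin: "finite {F. c F \<noteq> 0}" and fin_face: "\<And>F. c F \<noteq> 0 \<Longrightarrow> finite F"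
  shows "bdry (bdry c) = (\<lambda>G. 0)"
proof
  fix G
  define V where "V = \<Union> {F. c F \<noteq> 0}"
  have V: "finite V"
    using fin fin_face by (auto simp: V_def)
  have b1: "bdry c G' = (\<Sum>v | v \<in> V \<and> v \<notin> G'. (-1) ^ card {u \<in> G'. u < v} * c (insert v G'))" for G'
    by (rule bdry_eq[OF V]) (auto simp: V_def)
  have c0: "c F = 0" if "\<not> F \<subseteq> V" for F
    using that by (auto simp: V_def)
  have bsupp: "{v. v \<notin> G \<and> bdry c (insert v G) \<noteq> 0} \<subseteq> V"
  proof
    fix v assume v: "v \<in> {v. v \<notin> G \<and> bdry c (insert v G) \<noteq> 0}"
    show "v \<in> V"
    proof (rule ccontr)
      assume "v \<notin> V"
      then have "bdry c (insert v G) = 0"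
        unfolding b1 by (intro sum.neutral ballI) (auto intro!: c0)
      then show False using v by simp
    qed
  qed
  define sg where "sg v w = ((-1) ^ card {u \<in> G. u < v} * (-1) ^ card {u \<in> insert v G. u < w} :: rat)" for v w
  define h where "h v w = (if v = w then 0 else sg v w * c (insert v (insert w G)))" for v w
  let ?W = "{v. v \<in> V \<and> v \<notin> G}"
  have W: "finite ?W" using V by simp
  have "bdry (bdry c) G = (\<Sum>v\<in>?W. (-1) ^ card {u \<in> G. u < v} * bdry c (insert v G))"
    by (rule bdry_eq[OF V bsupp])
  also have "\<dots> = (\<Sum>v\<in>?W. \<Sum>w\<in>?W. h v w)"
  proof (rule sum.cong[OF refl])
    fix v assume "v \<in> ?W"
    have "(-1) ^ card {u \<in> G. u < v} * bdry c (insert v G) =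
        (\<Sum>w | w \<in> V \<and> w \<notin> insert v G. h v w)"
      unfolding b1 sum_distrib_left
      by (intro sum.cong refl) (auto simp: h_def sg_def insert_commute)
    also have "\<dots> = (\<Sum>w\<in>?W. h v w)"
      by (intro sum.mono_neutral_left W) (auto simp: h_def)
    finally show "(-1) ^ card {u \<in> G. u < v} * bdry c (insert v G) = (\<Sum>w\<in>?W. h v w)" .
  qed
  also have "\<dots> = 0"
  \<comment> \<open>For infinite \<open>G\<close> the default \<open>card\<close> value 0 may spoil
    the signs, but then \<open>c\<close> vanishes on every set containing \<open>G\<close>.\<close>
  proof (cases "finite G")
    case G: True
    have sg: "sg v w = - sg w v" if "v < w" "v \<notin> G" for v w
    proof -
      have "{u \<in> insert v G. u < w} = insert v {u \<in> G. u < w}" "{u \<in> insert w G. u < v} = {u \<in> G. u < v}"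
        using that by auto
      then show ?thesis using G that by (simp add: sg_def)
    qed
    have sg': "sg v w = - sg w v" if "v \<noteq> w" "v \<notin> G" "w \<notin> G" for v w
      using sg[of v w] sg[of w v] that by (cases "v < w") auto
    show ?thesis
    proof (rule sum_antisym_pairs_eq_0)
      fix v w assume "v \<in> ?W" "w \<in> ?W"
      then show "h v w = - h w v"
        using sg'[of v w] by (simp add: h_def insert_commute[of v w])
    qed
  next
    case False
    then have "c (insert v (insert w G)) = 0" for v w
      using fin_face[of "insert v (insert w G)"] by auto
    then show ?thesis by (simp add: h_def)
  qed
  finally show "bdry (bdry c) G = 0" .
qed

text \<open>The join of the chain with the vertex \<open>a\<close>. Only the coefficients of
  \<open>c\<close> at faces without \<open>a\<close> are read; faces that already contain
  \<open>a\<close> would become degenerate and are dropped.\<close>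

definition cone_chain :: "'a \<Rightarrow> ('a set \<Rightarrow> rat) \<Rightarrow> 'a set \<Rightarrow> rat" where
  "cone_chain a c G = (if a \<in> G then c (G - {a}) else 0)"

text \<open>The cone is a chain homotopy from the identity to zero. As \<open>a\<close> is the least
  vertex, it has position 0: deleting it gives \<open>c\<close> with sign +1, and its presence
  shifts all other positions by 1, whence the minus sign.\<close>

lemma bdry_cone_chain:
  fixes c :: "'a::linorder set \<Rightarrow> rat"
  assumes fin: "finite {F. c F \<noteq> 0}" and fin_face: "\<And>F. c F \<noteq> 0 \<Longrightarrow> finite F"
    and least: "\<And>F v. c F \<noteq> 0 \<Longrightarrow> v \<in> F \<Longrightarrow> a \<le> v"
  shows "bdry (cone_chain a c) = (\<lambda>G. c G - cone_chain a (bdry c) G)"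
proof
  fix G
  have below: "card {u \<in> G. u < a} = 0" if "c G \<noteq> 0"
    using least[OF that] by (force simp: card_eq_0_iff)
  show "bdry (cone_chain a c) G = c G - cone_chain a (bdry c) G"
  proof (cases "a \<in> G")
    case False
    have "bdry (cone_chain a c) G = (\<Sum>v | v \<in> {a} \<and> v \<notin> G. (-1) ^ card {u \<in> G. u < v} * cone_chain a c (insert v G))"
      by (rule bdry_eq) (use False in \<open>auto simp: cone_chain_def split: if_splits\<close>)
    also have "{v. v \<in> {a} \<and> v \<notin> G} = {a}" using False by auto
    also have "(\<Sum>v\<in>{a}. (-1) ^ card {u \<in> G. u < v} * cone_chain a c (insert v G)) = c G"
      using False below by (cases "c G = 0") (simp_all add: cone_chain_def)
    finally show ?thesis
      using False by (simp add: cone_chain_def[of a "bdry c" G])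
  next
    case True
    define H where "H = G - {a}"
    have G: "G = insert a H" "a \<notin> H" using True by (auto simp: H_def)
    define V where "V = insert a (\<Union> {F. c F \<noteq> 0})"
    have V: "finite V" using fin fin_face by (auto simp: V_def)
    let ?t = "\<lambda>v. (-1) ^ card {u \<in> H. u < v} * c (insert v H)"
    have "bdry c H = (\<Sum>v | v \<in> V \<and> v \<notin> H. ?t v)"
      by (rule bdry_eq[OF V]) (auto simp: V_def)
    \<comment> \<open>The faces of \<open>c\<close> through \<open>a\<close>, lost by coning,
      reappear as the term \<open>v = a\<close> of \<open>bdry c H\<close>, where they cancel
      \<open>c G\<close>.\<close>
    also have "\<dots> = ?t a + (\<Sum>v | v \<in> V \<and> v \<notin> G. ?t v)"
    proof -
      have "{v. v \<in> V \<and> v \<notin> H} = insert a {v. v \<in> V \<and> v \<notin> G}"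
        using G by (auto simp: V_def)
      then show ?thesis using V G by simp
    qed
    also have "?t a = c G"
    proof (cases "c G = 0")
      case False
      then have "{u \<in> H. u < a} = {}"
        using least[OF False] G by force
      then have "card {u \<in> H. u < a} = 0" by (simp only: card.empty)
      then show ?thesis using G by simp
    qed (use G in simp)
    finally have 1: "bdry c H = c G + (\<Sum>v | v \<in> V \<and> v \<notin> G. ?t v)" .
    have "bdry (cone_chain a c) G =
        (\<Sum>v | v \<in> V \<and> v \<notin> G. (-1) ^ card {u \<in> G. u < v} * cone_chain a c (insert v G))"
    proof (rule bdry_eq[OF V])
      show "{v. v \<notin> G \<and> cone_chain a c (insert v G) \<noteq> 0} \<subseteq> V"
        using True by (auto simp: cone_chain_def V_def)
    qed
    also have "\<dots> = (\<Sum>v | v \<in> V \<and> v \<notin> G. - ?t v)"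
    proof (rule sum.cong[OF refl])
      fix v assume v: "v \<in> {v. v \<in> V \<and> v \<notin> G}"
      have eq: "cone_chain a c (insert v G) = c (insert v H)"
        using v True by (auto simp: cone_chain_def H_def insert_Diff_if)
      show "(-1) ^ card {u \<in> G. u < v} * cone_chain a c (insert v G) = - ?t v"
      proof (cases "c (insert v H) = 0")
        case False
        have "a \<le> v" using least[OF False, of v] by simp
        moreover have "a \<noteq> v" using v True by auto
        ultimately have "a < v" by simp
        then have "{u \<in> G. u < v} = insert a {u \<in> H. u < v}"
          using G by auto
        moreover have "finite H" using fin_face[OF False] by simp
        ultimately show ?thesis unfolding eq using G by simp
      qed (simp add: eq)
    qed
    also have "\<dots> = c G - bdry c H"
      using 1 by (simp add: sum_negf)
    finally show ?thesis
      using True by (simp add: cone_chain_def H_def)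
  qed
qed

text \<open>The coefficients at \<open>S\<close> are coordinates on the quotient. The proof uses the
  inverse map, from a vector to the class of the combination of the \<open>z s\<close>, which is
  well defined without further ado: \<open>vanish\<close> and \<open>dual\<close> make it injective,
  \<open>exact\<close> makes it surjective.\<close>

lemma dim_quotient_space:
  fixes Z B :: "('b \<Rightarrow> rat) set"
  assumes Z: "rat_subspace Z" and B: "rat_subspace B" and BZ: "B \<subseteq> Z" and S: "finite S"
    and z: "\<And>s. s \<in> S \<Longrightarrow> z s \<in> Z"
    and dual: "\<And>s t. s \<in> S \<Longrightarrow> t \<in> S \<Longrightarrow> z s t = (if s = t then 1 else 0)"
    and vanish: "\<And>b s. b \<in> B \<Longrightarrow> s \<in> S \<Longrightarrow> b s = 0"
    and exact: "\<And>c. c \<in> Z \<Longrightarrow> (\<And>s. s \<in> S \<Longrightarrow> c s = 0) \<Longrightarrow> c \<in> B"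
  shows "vectorspace.dim rat_field (quotient_space Z B) = card S"
proof -
  define n where "n = card S"
  obtain e where e: "bij_betw e {..<n} S"
    using ex_bij_betw_nat_finite[OF S] by (auto simp: n_def atLeast0LessThan)
  let ?V = "module_vec TYPE(rat) n" and ?W = "quotient_space Z B"
  have rf: "rat_field = class_ring" by (simp add: rat_field_def)
  have Bz: "(\<lambda>x. 0) \<in> B" and Ba: "\<And>f g. f \<in> B \<Longrightarrow> g \<in> B \<Longrightarrow> (\<lambda>x. f x + g x) \<in> B"
    and Bs: "\<And>r f. f \<in> B \<Longrightarrow> (\<lambda>x. r * f x) \<in> B"
    using B by (auto simp: rat_subspace_def)
  have Zz: "(\<lambda>x. 0) \<in> Z" and Za: "\<And>f g. f \<in> Z \<Longrightarrow> g \<in> Z \<Longrightarrow> (\<lambda>x. f x + g x) \<in> Z"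
    and Zs: "\<And>r f. f \<in> Z \<Longrightarrow> (\<lambda>x. r * f x) \<in> Z"
    using Z by (auto simp: rat_subspace_def)
  define cs where "cs f = {\<lambda>x. f x + b x | b. b \<in> B}" for f :: "'b \<Rightarrow> rat"
  have Bd: "(\<lambda>x. f x - g x) \<in> B" if "f \<in> B" "g \<in> B" for f g
    using Ba[OF that(1) Bs[OF that(2), of "-1"]] by simp
  have cs_eq: "cs f = cs g \<longleftrightarrow> (\<lambda>x. f x - g x) \<in> B" for f g
  proof
    assume "cs f = cs g"
    moreover have "f \<in> cs f" unfolding cs_def using Bz by force
    ultimately obtain b where "b \<in> B" "f = (\<lambda>x. g x + b x)" by (auto simp: cs_def)
    then show "(\<lambda>x. f x - g x) \<in> B" by simp
  next
    assume d: "(\<lambda>x. f x - g x) \<in> B"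
    have "cs f \<subseteq> cs g" if d: "(\<lambda>x. f x - g x) \<in> B" for f g
    proof
      fix h assume "h \<in> cs f"
      then obtain b where b: "b \<in> B" "h = (\<lambda>x. f x + b x)" by (auto simp: cs_def)
      show "h \<in> cs g" unfolding cs_def mem_Collect_eq
        using Ba[OF b(1) d] b(2) by (intro exI[of _ "\<lambda>x. b x + (f x - g x)"]) auto
    qed
    moreover have "(\<lambda>x. g x - f x) \<in> B" using Bs[OF d, of "-1"] by simp
    ultimately show "cs f = cs g" using d by blast
  qed
  have car: "carrier ?W = cs ` Z"
    by (auto simp: quotient_space_def cs_def)
  have add: "add ?W (cs f) (cs g) = cs (\<lambda>x. f x + g x)" for f g
  proof (intro equalityI subsetI)
    fix h assume "h \<in> add ?W (cs f) (cs g)"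
    then obtain b d where "b \<in> B" "d \<in> B" "h = (\<lambda>x. (f x + b x) + (g x + d x))"
      by (auto simp: quotient_space_def cs_def)
    then show "h \<in> cs (\<lambda>x. f x + g x)" unfolding cs_def mem_Collect_eq
      by (intro exI[of _ "\<lambda>x. b x + d x"]) (auto simp: Ba algebra_simps)
  next
    fix h assume "h \<in> cs (\<lambda>x. f x + g x)"
    then obtain b where b: "b \<in> B" "h = (\<lambda>x. f x + g x + b x)" by (auto simp: cs_def)
    have "(\<lambda>x. f x + b x) \<in> cs f" "g \<in> cs g" unfolding cs_def using Bz b(1) by force+
    moreover have "h = (\<lambda>x. (f x + b x) + g x)" by (simp add: b(2) algebra_simps)
    ultimately show "h \<in> add ?W (cs f) (cs g)"
      unfolding quotient_space_def by fastforce
  qed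
  have smult: "smult ?W r (cs f) = cs (\<lambda>x. r * f x)" for r f
  proof (intro equalityI subsetI)
    fix h assume "h \<in> smult ?W r (cs f)"
    then obtain b d where "b \<in> B" "d \<in> B" "h = (\<lambda>x. r * (f x + b x) + d x)"
      by (auto simp: quotient_space_def cs_def)
    then show "h \<in> cs (\<lambda>x. r * f x)" unfolding cs_def mem_Collect_eq
      by (intro exI[of _ "\<lambda>x. r * b x + d x"]) (auto simp: Ba Bs algebra_simps)
  next
    fix h assume "h \<in> cs (\<lambda>x. r * f x)"
    then obtain b where b: "b \<in> B" "h = (\<lambda>x. r * f x + b x)" by (auto simp: cs_def)
    have "f \<in> cs f" unfolding cs_def using Bz by force
    then show "h \<in> smult ?W r (cs f)"
      unfolding quotient_space_def using b by auto
  qed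
  define g where "g v = (\<lambda>x. \<Sum>i<n. vec_index v i * z (e i) x)" for v :: "rat vec"
  have e_in: "e i \<in> S" if "i < n" for i using e that by (auto simp: bij_betw_def)
  have e_eq: "e i = e k \<longleftrightarrow> i = k" if "i < n" "k < n" for i k
    using e that by (auto simp: bij_betw_def inj_on_def)
  have gZ: "g v \<in> Z" for v
  proof -
    have "(\<lambda>x. \<Sum>i<k. vec_index v i * z (e i) x) \<in> Z" if "k \<le> n" for k
      using that
    proof (induction k)
      case (Suc k)
      then show ?case using Za[OF Suc.IH Zs[OF z[OF e_in]], of k "vec_index v k"] by simp
    qed (simp add: Zz)
    then show ?thesis by (simp add: g_def)
  qed
  have g_coeff: "g v (e k) = vec_index v k" if "k < n" for v k
  proof -
    have "g v (e k) = (\<Sum>i<n. if i = k then vec_index v i else 0)"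
      unfolding g_def using that by (intro sum.cong refl) (auto simp: dual e_in e_eq)
    then show ?thesis using that by simp
  qed
  interpret V: vec_space "TYPE(rat)" n .
  have vW: "vectorspace rat_field ?W" by (rule vectorspace_quotient_space[OF Z B])
  have "linear_map class_ring ?V ?W (\<lambda>v. cs (g v))"
  proof (intro linear_map.intro mod_hom.intro mod_hom_axioms.intro)
    show "vectorspace class_ring ?W" using vW by (simp add: rf)
    then show "Module.module class_ring ?W" by (simp add: vectorspace_def)
    show "(\<lambda>v. cs (g v)) \<in> module_hom class_ring ?V ?W"
      unfolding module_hom_def
    proof (intro CollectI conjI allI impI)
      show "(\<lambda>v. cs (g v)) \<in> carrier ?V \<rightarrow> carrier ?W" by (auto simp: car gZ)
    next
      fix v w assume "v \<in> carrier ?V \<and> w \<in> carrier ?V"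
      then have "g (v + w) = (\<lambda>x. g v x + g w x)"
        by (auto simp: g_def module_vec_def sum.distrib algebra_simps fun_eq_iff intro!: sum.cong)
      then show "cs (g (v \<oplus>\<^bsub>?V\<^esub> w)) = cs (g v) \<oplus>\<^bsub>?W\<^esub> cs (g w)"
        by (simp add: add module_vec_def)
    next
      fix r v assume "r \<in> carrier (class_ring :: rat ring) \<and> v \<in> carrier ?V"
      then have "g (r \<cdot>\<^sub>v v) = (\<lambda>x. r * g v x)"
        by (auto simp: g_def module_vec_def sum_distrib_left algebra_simps fun_eq_iff intro!: sum.cong)
      then show "cs (g (r \<odot>\<^bsub>?V\<^esub> v)) = r \<odot>\<^bsub>?W\<^esub> cs (g v)"
        by (simp add: smult module_vec_def)
    qed
  qed unfold_locales
  then interpret L: linear_map class_ring ?V ?W "\<lambda>v. cs (g v)" .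
  have inj: "inj_on (\<lambda>v. cs (g v)) (carrier ?V)"
  proof (rule inj_onI)
    fix v w assume vw: "v \<in> carrier ?V" "w \<in> carrier ?V" and "cs (g v) = cs (g w)"
    then have "(\<lambda>x. g v x - g w x) \<in> B" by (simp add: cs_eq)
    then have "vec_index v k = vec_index w k" if "k < n" for k
      using vanish[OF _ e_in[OF that]] g_coeff[OF that] by force
    then show "v = w" using vw by (intro eq_vecI) (auto simp: module_vec_def)
  qed
  have surj: "(\<lambda>v. cs (g v)) ` carrier ?V = carrier ?W"
  proof
    show "(\<lambda>v. cs (g v)) ` carrier ?V \<subseteq> carrier ?W" by (auto simp: car gZ)
    show "carrier ?W \<subseteq> (\<lambda>v. cs (g v)) ` carrier ?V"
    proof
      fix h assume "h \<in> carrier ?W"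
      then obtain c where c: "c \<in> Z" "h = cs c" by (auto simp: car)
      let ?v = "vec n (\<lambda>i. c (e i))"
      \<comment> \<open>The combination \<open>g ?v\<close> has the same coefficients on
        \<open>S\<close> as \<open>c\<close>, so \<open>exact\<close> applies to the
        difference.\<close>
      have "(\<lambda>x. c x - g ?v x) \<in> B"
      proof (rule exact)
        show "(\<lambda>x. c x - g ?v x) \<in> Z"
          using Za[OF c(1) Zs[OF gZ, of "-1" ?v]] by simp
        fix s assume "s \<in> S"
        then obtain k where "k < n" "s = e k" using e by (auto simp: bij_betw_def)
        then show "c s - g ?v s = 0" by (simp add: g_coeff)
      qed
      then have "h = cs (g ?v)" by (simp add: c cs_eq)
      then show "h \<in> (\<lambda>v. cs (g v)) ` carrier ?V" by (auto simp: module_vec_def)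
    qed
  qed
  show ?thesis
    using L.dim_eq[OF V.fin_dim inj surj] V.dim_is_n by (simp add: rf n_def)
qed

lemma rat_subspace_cycles: "rat_subspace (cycles K m)"
  using rat_subspace_chains[of K m] unfolding rat_subspace_def cycles_def
  by (auto simp: bdry_scale bdry_add) (simp add: bdry_def fun_eq_iff)

lemma rat_subspace_boundaries: "rat_subspace (boundaries K m)"
proof -
  have C: "(\<lambda>x. 0) \<in> chains K (Suc m)"
    "\<And>f g. f \<in> chains K (Suc m) \<Longrightarrow> g \<in> chains K (Suc m) \<Longrightarrow> (\<lambda>x. f x + g x) \<in> chains K (Suc m)"
    "\<And>r f. f \<in> chains K (Suc m) \<Longrightarrow> (\<lambda>x. r * f x) \<in> chains K (Suc m)"
    using rat_subspace_chains[of K "Suc m"] by (auto simp: rat_subspace_def)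
  have "bdry (\<lambda>F. 0) = (\<lambda>G. 0)"
    by (simp add: bdry_def fun_eq_iff)
  then have "(\<lambda>x. 0) \<in> bdry ` chains K (Suc m)"
    by (intro image_eqI[OF _ C(1)]) (rule sym)
  then show ?thesis
    unfolding rat_subspace_def boundaries_def
    using C(2,3) by (auto simp: bdry_add[symmetric] bdry_scale[symmetric])
qed

lemma chainsD:
  assumes "c \<in> chains K m" "c F \<noteq> 0"
  shows "F \<in> insert {} K" "finite F" "card F = m"
  using assms unfolding chains_def by blast+

section \<open>Cones with attached facets\<close>

locale cone_with_facets =
  fixes K :: "'a set set" and a :: 'a
  assumes finite_complex: "finite K"
    and finite_face: "F \<in> K \<Longrightarrow> finite F"
    and nonempty_face: "F \<in> K \<Longrightarrow> F \<noteq> {}"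
    and subface: "F \<in> K \<Longrightarrow> G \<subseteq> F \<Longrightarrow> G \<noteq> {} \<Longrightarrow> G \<in> K"
    and apex: "{a} \<in> K"
    and cone_proper: "F \<in> K \<Longrightarrow> insert a F \<notin> K \<Longrightarrow> G \<subset> F \<Longrightarrow> G \<noteq> {} \<Longrightarrow> insert a G \<in> K"
begin

text \<open>Maximal faces that contain the apex are not counted as facets.\<close>

definition facets :: "'a set set" where
  "facets = {F \<in> K. insert a F \<notin> K}"

lemma facet_face: "F \<in> facets \<Longrightarrow> F \<in> K"
  by (simp add: facets_def)

lemma cone_face: "F \<in> K \<Longrightarrow> F \<notin> facets \<Longrightarrow> insert a F \<in> K"
  by (simp add: facets_def)

text \<open>A larger face \<open>S\<close> could not be coned off either, since its cone would
  contain \<open>insert a F\<close>. But then \<open>cone_proper\<close>, applied to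
  \<open>S\<close>, would make \<open>insert a F\<close> a face.\<close>

lemma facet_maximal:
  assumes "F \<in> facets" "S \<in> K" "F \<subseteq> S"
  shows "S = F"
proof (rule ccontr)
  assume "S \<noteq> F"
  then have "F \<subset> S" using assms(3) by blast
  have F: "F \<in> K" "insert a F \<notin> K" using assms(1) by (simp_all add: facets_def)
  have "insert a F \<subseteq> insert a S" using assms(3) by blast
  then have "insert a S \<notin> K"
    using F(2) subface[of "insert a S" "insert a F"] by blast
  then show False
    using cone_proper[OF assms(2) _ \<open>F \<subset> S\<close> nonempty_face[OF F(1)]] F(2) by blast
qed

lemma apex_notin_facet: "F \<in> facets \<Longrightarrow> a \<notin> F"
  by (metis (no_types, lifting) facets_def insert_absorb mem_Collect_eq)

lemma finite_facets: "finite facets"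
  using finite_complex by (simp add: facets_def)

text \<open>Adds the empty \<open>G\<close>, which is no face but occurs when the vertex of a
  singleton facet is removed.\<close>

lemma facet_cone_proper:
  assumes "F \<in> facets" "G \<subset> F"
  shows "insert a G \<in> K"
proof (cases "G = {}")
  case True then show ?thesis using apex by simp
next
  case False
  then show ?thesis using assms cone_proper[of F G] by (simp add: facets_def)
qed

lemma chains_iff: "c \<in> chains K m \<longleftrightarrow> (\<forall>F. c F \<noteq> 0 \<longrightarrow> F \<in> insert {} K \<and> card F = m)"
proof (intro iffI allI impI conjI)
  assume h: "\<forall>F. c F \<noteq> 0 \<longrightarrow> F \<in> insert {} K \<and> card F = m"
  then have "{F. c F \<noteq> 0} \<subseteq> insert {} K" by blast
  then have "finite {F. c F \<noteq> 0}"
    using finite_complex finite_subset by blast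
  moreover have "finite F" if "F \<in> insert {} K" for F
    using that finite_face by blast
  ultimately show "c \<in> chains K m"
    using h unfolding chains_def by blast
qed (use chainsD in blast)+

end

text \<open>The order fixes the orientations of the faces. With the apex least, coning prepends a
  vertex and its boundary formula has uniform signs.\<close>

locale least_cone_with_facets = cone_with_facets K a for K :: "'a::linorder set set" and a +
  assumes apex_least: "F \<in> K \<Longrightarrow> v \<in> F \<Longrightarrow> a \<le> v"
begin

lemma chain_supports:
  assumes "c \<in> chains K m"
  shows "finite {F. c F \<noteq> 0}" "\<And>F. c F \<noteq> 0 \<Longrightarrow> finite F" "\<And>F v. c F \<noteq> 0 \<Longrightarrow> v \<in> F \<Longrightarrow> a \<le> v"
proof -
  show "finite {F. c F \<noteq> 0}" using assms by (simp add: chains_def)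
  show "finite F" if "c F \<noteq> 0" for F using chainsD[OF assms that] by blast
  show "a \<le> v" if "c F \<noteq> 0" "v \<in> F" for F v
    using chainsD[OF assms that(1)] that(2) apex_least by blast
qed

lemma bdry_in_chains:
  assumes c: "c \<in> chains K (Suc m)"
  shows "bdry c \<in> chains K m"
  unfolding chains_iff
proof (intro allI impI)
  fix G assume "bdry c G \<noteq> 0"
  then obtain v where v: "v \<notin> G" "c (insert v G) \<noteq> 0"
    by (rule bdry_nonzeroE)
  have "insert v G \<in> K" "card (insert v G) = Suc m" "finite (insert v G)"
    using chainsD[OF c v(2)] by blast+
  then show "G \<in> insert {} K \<and> card G = m"
    using v(1) subface[of "insert v G" G] by (auto simp del: One_nat_def)
qed

text \<open>The coordinates are the coefficients at facets. Boundaries have none, because facets are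
  maximal. The boundary of the missing simplex \<open>insert a F\<close> has coefficient 1 at
  \<open>F\<close> and 0 at all other facets, because its other faces contain the apex.\<close>

theorem dim_reduced_homology_eq:
  "dim_reduced_homology K j = card {F \<in> facets. card F = Suc j}"
  unfolding dim_reduced_homology_def reduced_homology_def
proof (rule dim_quotient_space[OF rat_subspace_cycles rat_subspace_boundaries])
  let ?S = "{F \<in> facets. card F = Suc j}"
  define d where "d F = (\<lambda>G. if G = F then 1 else 0 :: rat)" for F :: "'a set"
  \<comment> \<open>\<^term>\<open>insert a F\<close> is not a face of \<^term>\<open>K\<close>, so this cycle of \<^term>\<open>K\<close> need not be a boundary in \<^term>\<open>K\<close>.\<close>
  define z where "z F = bdry (cone_chain a (d F))" for F
  show "finite ?S" using finite_facets by simp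
  show "boundaries K (Suc j) \<subseteq> cycles K (Suc j)"
  proof
    fix b assume "b \<in> boundaries K (Suc j)"
    then obtain c where c: "c \<in> chains K (Suc (Suc j))" "b = bdry c"
      by (auto simp: boundaries_def)
    then show "b \<in> cycles K (Suc j)"
      using bdry_bdry[OF chain_supports(1,2)[OF c(1)]] bdry_in_chains[OF c(1)]
      by (simp add: cycles_def)
  qed
  have d: "d F \<in> chains K (Suc j)" if "F \<in> ?S" for F
    using that facet_face by (auto simp: chains_iff d_def)
  have z: "z F = (\<lambda>G. d F G - cone_chain a (bdry (d F)) G)" if "F \<in> ?S" for F
    unfolding z_def by (rule bdry_cone_chain) (use chain_supports[OF d[OF that]] in auto)
  show "z F \<in> cycles K (Suc j)" if F: "F \<in> ?S" for F
    unfolding cycles_def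
  proof (intro CollectI conjI)
    have fin: "finite F" using F facet_face finite_face by auto
    show "z F \<in> chains K (Suc j)"
      unfolding chains_iff
    proof (intro allI impI)
      fix G assume "z F G \<noteq> 0"
      then consider "G = F" | "a \<in> G" "bdry (d F) (G - {a}) \<noteq> 0"
        by (auto simp: z[OF F] d_def cone_chain_def split: if_splits)
      then show "G \<in> insert {} K \<and> card G = Suc j"
      proof cases
        case 1 then show ?thesis using F facet_face by auto
      next
        case 2
        then obtain v where v: "v \<notin> G - {a}" "insert v (G - {a}) = F"
          unfolding d_def by (elim bdry_nonzeroE) (metis (mono_tags))
        then have "v \<noteq> a" using F apex_notin_facet by auto
        then have G: "G = insert a (F - {v})" "v \<in> F" using v 2 by auto
        then have "insert a (F - {v}) \<in> K" using F by (intro facet_cone_proper[of F]) auto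
        moreover have "card G = card F"
        proof -
          have "a \<notin> F - {v}" using apex_notin_facet F by blast
          then show ?thesis
            unfolding G(1) card.remove[OF fin G(2)] by (rule card_insert_disjoint[OF finite_Diff[OF fin]])
        qed
        ultimately show ?thesis using G F by simp
      qed
    qed
    have "finite {G. cone_chain a (d F) G \<noteq> 0}"
      by (rule finite_subset[of _ "{insert a F}"]) (auto simp: cone_chain_def d_def split: if_splits)
    then show "bdry (z F) = (\<lambda>G. 0)"
      unfolding z_def using fin
      by (intro bdry_bdry) (auto simp: cone_chain_def d_def split: if_splits)
  qed
  show "z F G = (if F = G then 1 else 0)" if "F \<in> ?S" "G \<in> ?S" for F G
    using that apex_notin_facet[of G] by (auto simp: z cone_chain_def d_def)
  show "b F = 0" if b: "b \<in> boundaries K (Suc j)" and F: "F \<in> ?S" for b F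
  proof -
    obtain c where c: "c \<in> chains K (Suc (Suc j))" "b = bdry c"
      using b by (auto simp: boundaries_def)
    show ?thesis
    proof (rule ccontr)
      assume "b F \<noteq> 0"
      then obtain v where v: "v \<notin> F" "c (insert v F) \<noteq> 0"
        unfolding c(2) by (rule bdry_nonzeroE)
      have "insert v F \<in> K" using chainsD(1)[OF c(1) v(2)] by blast
      then show False using facet_maximal[of F "insert v F"] F v(1) by auto
    qed
  qed
  show "c \<in> boundaries K (Suc j)"
    if c: "c \<in> cycles K (Suc j)" and c0: "\<And>F. F \<in> ?S \<Longrightarrow> c F = 0" for c
  proof -
    have ch: "c \<in> chains K (Suc j)" and "bdry c = (\<lambda>G. 0)"
      using c by (auto simp: cycles_def)
    moreover have "bdry (cone_chain a c) = (\<lambda>G. c G - cone_chain a (bdry c) G)"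
      by (rule bdry_cone_chain) (use chain_supports[OF ch] in auto)
    ultimately have "bdry (cone_chain a c) = c"
      by (simp add: cone_chain_def)
    moreover have "cone_chain a c \<in> chains K (Suc (Suc j))"
      unfolding chains_iff
    proof (intro allI impI)
      fix G assume "cone_chain a c G \<noteq> 0"
      then have G: "a \<in> G" "c (G - {a}) \<noteq> 0" by (auto simp: cone_chain_def split: if_splits)
      then have card: "card (G - {a}) = Suc j" and "G - {a} \<in> insert {} K" "finite (G - {a})"
        using chainsD[OF ch G(2)] by blast+
      \<comment> \<open>The empty face, which \<open>chains\<close> admits, is ruled out by the
        cardinality \<open>Suc j\<close>.\<close>
      then have "G - {a} \<in> K" by (metis card.empty insertE nat.distinct(1))
      moreover have "G - {a} \<notin> facets" using G c0 card by auto
      ultimately have "insert a (G - {a}) \<in> K" by (rule cone_face)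
      then show "G \<in> insert {} K \<and> card G = Suc (Suc j)"
        using G(1) card card.remove[of G a] \<open>finite (G - {a})\<close> by (simp only: insert_Diff finite_Diff2 finite.emptyI finite.insertI) simp
    qed
    ultimately show ?thesis unfolding boundaries_def by (intro image_eqI) simp_all
  qed
qed

end

section \<open>Quotient maps and wedges\<close>

text \<open>The argument that crushing a contractible part changes nothing, in terms of a
  deformation \<open>h\<close>. Since \<open>h (1, _)\<close> is constant on the fibres of
  \<open>f\<close>, it factors through a map \<open>g\<close> from \<open>W\<close> back to
  \<open>X\<close>; since every \<open>h (t, _)\<close> respects the fibres, \<open>h\<close>
  induces a homotopy on \<open>W\<close>. These two homotopies show that \<open>f\<close> and
  \<open>g\<close> are inverse to each other.\<close>

lemma homotopy_equivalent_space_quotient: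
  assumes f: "quotient_map X W f"
    and h: "continuous_map (prod_topology (top_of_set {0..1::real}) X) X h"
    and h0: "\<And>x. x \<in> topspace X \<Longrightarrow> h (0, x) = x"
    and h_cong: "\<And>t x y. t \<in> {0..1} \<Longrightarrow> x \<in> topspace X \<Longrightarrow> y \<in> topspace X \<Longrightarrow> f x = f y \<Longrightarrow>
       f (h (t, x)) = f (h (t, y))"
    and h1: "\<And>x y. x \<in> topspace X \<Longrightarrow> y \<in> topspace X \<Longrightarrow> f x = f y \<Longrightarrow> h (1, x) = h (1, y)"
  shows "X homotopy_equivalent_space W"
proof -
  let ?I = "top_of_set {0..1::real}"
  have cf: "continuous_map X W f" using f by (rule quotient_imp_continuous_map)
  have surj: "f ` topspace X = topspace W" using f by (rule quotient_imp_surjective_map)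
  have ch1: "continuous_map X X (\<lambda>x. h (1, x))"
  proof -
    have "continuous_map X (prod_topology ?I X) (\<lambda>x. (1, x))"
      by (intro continuous_map_pairedI) auto
    from continuous_map_compose[OF this h] show ?thesis by (simp add: o_def)
  qed
  obtain g where g: "continuous_map W X g" "\<And>x. x \<in> topspace X \<Longrightarrow> g (f x) = h (1, x)"
  proof (rule quotient_map_lift_exists[OF f ch1])
    show "h (1, x) = h (1, y)" if "x \<in> topspace X" "y \<in> topspace X" "f x = f y" for x y
      using that by (rule h1)
  qed auto
  let ?Q = "\<lambda>(t, x). (t, f x)"
  \<comment> \<open>A product with a quotient map need not be a quotient map; here it is one because
    the interval is locally compact and Hausdorff.\<close>
  have Q: "quotient_map (prod_topology ?I X) (prod_topology ?I W) ?Q"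
    by (rule quotient_map_prod_right[OF _ _ f])
       (auto simp: compact_imp_locally_compact_space compact_space_subtopology Hausdorff_space_subtopology)
  have fh: "continuous_map (prod_topology ?I X) W (f \<circ> h)"
    by (rule continuous_map_compose[OF h cf])
  obtain k where k: "continuous_map (prod_topology ?I W) W k"
    "\<And>p. p \<in> topspace (prod_topology ?I X) \<Longrightarrow> k (?Q p) = (f \<circ> h) p"
  proof (rule quotient_map_lift_exists[OF Q fh])
    fix p r assume pr: "p \<in> topspace (prod_topology ?I X)" "r \<in> topspace (prod_topology ?I X)" "?Q p = ?Q r"
    obtain t x t' y where "p = (t, x)" "r = (t', y)" by fastforce
    then show "(f \<circ> h) p = (f \<circ> h) r"
      using pr h_cong[of t x y] by simp
  qed auto
  have "homotopic_with (\<lambda>x. True) X X (\<lambda>x. x) (g \<circ> f)"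
    by (subst homotopic_with) (use h h0 g(2) in \<open>auto intro!: exI[of _ h] simp del: split_paired_All split_paired_Ex\<close>)
  moreover have "homotopic_with (\<lambda>x. True) W W (\<lambda>x. x) (f \<circ> g)"
  proof (subst homotopic_with)
    have "k (0, w) = w \<and> k (1, w) = f (g w)" if w: "w \<in> topspace W" for w
    proof -
      obtain x where x: "x \<in> topspace X" "w = f x" using surj w by auto
      then show ?thesis
        using k(2)[of "(0, x)"] k(2)[of "(1, x)"] h0 g(2) by (simp add: topspace_prod_topology)
    qed
    then show "\<exists>h. continuous_map (prod_topology ?I W) W h \<and> (\<forall>x\<in>topspace W. h (0, x) = x) \<and>
        (\<forall>x\<in>topspace W. h (1, x) = (f \<circ> g) x) \<and> (\<forall>t\<in>{0..1}. True)"
      using k(1) by (intro exI[of _ k]) auto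
  qed auto
  ultimately show ?thesis
    unfolding homotopy_equivalent_space_def id_def
    using cf g(1)
    by (intro exI[of _ f] exI[of _ g]) (simp add: homotopic_with_sym[of _ _ _ "_ \<circ> _"])
qed

text \<open>Each \<open>\<Phi> i\<close> is a quotient map, being a continuous surjection from a
  compact to a Hausdorff space. So it is enough to express the preimage of \<open>U\<close> under
  \<open>f\<close> through the preimages under the \<open>\<Phi> i\<close> and conversely. The point
  \<open>x0\<close> ensures that the base point is hit even when \<open>I\<close> is empty.\<close>

lemma quotient_map_onto_wedge:
  assumes X: "compact_space X" and I: "finite I"
    and Haus: "\<And>i. i \<in> I \<Longrightarrow> Hausdorff_space (Y i)" and p: "\<And>i. i \<in> I \<Longrightarrow> p i \<in> topspace (Y i)"
    and cont: "\<And>i. i \<in> I \<Longrightarrow> continuous_map X (Y i) (\<Phi> i)"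
    and surj: "\<And>i. i \<in> I \<Longrightarrow> \<Phi> i ` topspace X = topspace (Y i)"
    and disj: "\<And>i j x. i \<in> I \<Longrightarrow> j \<in> I \<Longrightarrow> x \<in> topspace X \<Longrightarrow> \<Phi> i x \<noteq> p i \<Longrightarrow> \<Phi> j x \<noteq> p j \<Longrightarrow> i = j"
    and base: "x0 \<in> topspace X" "\<And>i. i \<in> I \<Longrightarrow> \<Phi> i x0 = p i"
    and f_in: "\<And>i x. i \<in> I \<Longrightarrow> x \<in> topspace X \<Longrightarrow> \<Phi> i x \<noteq> p i \<Longrightarrow> f x = Some (i, \<Phi> i x)"
    and f_out: "\<And>x. x \<in> topspace X \<Longrightarrow> (\<And>i. i \<in> I \<Longrightarrow> \<Phi> i x = p i) \<Longrightarrow> f x = None"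
  shows "quotient_map X (wedge I Y p) f"
proof -
  let ?T = "topspace X"
  have f_cases: "(\<exists>i\<in>I. \<Phi> i x \<noteq> p i \<and> f x = Some (i, \<Phi> i x)) \<or> (\<forall>i\<in>I. \<Phi> i x = p i) \<and> f x = None"
    if "x \<in> ?T" for x
    using f_in[OF _ that] f_out[OF that] by blast
  have \<Phi>_in: "\<Phi> i x \<in> topspace (Y i)" if "i \<in> I" "x \<in> ?T" for i x
    using surj that by blast
  have im: "f ` ?T = wedge_points I Y p"
  proof
    show "f ` ?T \<subseteq> wedge_points I Y p"
    proof
      fix w assume "w \<in> f ` ?T"
      then obtain x where x: "x \<in> ?T" "w = f x" by auto
      have "w = None \<or> (\<exists>i\<in>I. w = wedge_incl p i (\<Phi> i x))"
        using f_cases[OF x(1)] x(2) by (auto simp: wedge_incl_def)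
      then show "w \<in> wedge_points I Y p"
        using \<Phi>_in[OF _ x(1)] unfolding wedge_points_def by blast
    qed
    show "wedge_points I Y p \<subseteq> f ` ?T"
    proof
      fix w assume "w \<in> wedge_points I Y p"
      then consider "w = None" | i y where "i \<in> I" "y \<in> topspace (Y i)" "y \<noteq> p i" "w = Some (i, y)"
        by (auto simp: wedge_points_def wedge_incl_def split: if_splits)
      then show "w \<in> f ` ?T"
      proof cases
        case 1
        then show ?thesis using f_out[OF base(1) base(2)] base(1) by (intro image_eqI[of _ _ x0]) auto
      next
        case 2
        then obtain x where "x \<in> ?T" "y = \<Phi> i x" using surj by blast
        then show ?thesis using f_in[of i x] 2 by (intro image_eqI[of _ _ x]) auto
      qed
    qed
  qed
  define pre where "pre U i = {y \<in> topspace (Y i). wedge_incl p i y \<in> U}" for U i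
  have quot: "quotient_map X (Y i) (\<Phi> i)" if "i \<in> I" for i
    using continuous_imp_quotient_map[OF cont X Haus surj] that by blast
  have out_open: "openin X {x \<in> ?T. \<Phi> i x \<noteq> p i}" if "i \<in> I" for i
  proof -
    have "openin (Y i) (topspace (Y i) - {p i})"
      using closedin_Hausdorff_singleton[OF Haus p] that by blast
    then have "openin X {x \<in> ?T. \<Phi> i x \<in> topspace (Y i) - {p i}}"
      by (rule openin_continuous_map_preimage[OF cont[OF that]])
    also have "{x \<in> ?T. \<Phi> i x \<in> topspace (Y i) - {p i}} = {x \<in> ?T. \<Phi> i x \<noteq> p i}"
      using \<Phi>_in[OF that] by auto
    finally show ?thesis .
  qed
  have "openin X {x \<in> ?T. f x \<in> U} \<longleftrightarrow> (\<forall>i\<in>I. openin (Y i) (pre U i))" if "U \<subseteq> wedge_points I Y p" for U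
  proof -
    have pre_iff: "\<Phi> i x \<in> pre U i \<longleftrightarrow> (if \<Phi> i x = p i then None \<in> U else f x \<in> U)" if "i \<in> I" "x \<in> ?T" for i x
      using f_in[OF that] \<Phi>_in[OF that] by (auto simp: pre_def wedge_incl_def)
    have open_pre: "openin (Y i) (pre U i) \<longleftrightarrow> openin X {x \<in> ?T. \<Phi> i x \<in> pre U i}" if "i \<in> I" for i
    proof -
      have "pre U i \<subseteq> topspace (Y i)" by (auto simp: pre_def)
      then show ?thesis using quot[OF that] unfolding quotient_map_def by blast
    qed
    show ?thesis
    \<comment> \<open>If \<open>U\<close> contains the base point, its preimage is a finite
      intersection, and a single \<open>\<Phi> i\<close>-preimage exceeds it only by points where
      another \<open>\<Phi> j\<close> leaves its base point. Otherwise it is a union, and a single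
      preimage is cut out by the open condition that \<open>\<Phi> i\<close> leaves its base
      point.\<close>
    proof (cases "None \<in> U")
      case True
      have eq: "{x \<in> ?T. f x \<in> U} = ?T \<inter> (\<Inter>i\<in>I. {x \<in> ?T. \<Phi> i x \<in> pre U i})"
      proof (intro equalityI subsetI)
        fix x assume "x \<in> {x \<in> ?T. f x \<in> U}"
        then show "x \<in> ?T \<inter> (\<Inter>i\<in>I. {x \<in> ?T. \<Phi> i x \<in> pre U i})"
          using pre_iff[of _ x] True by simp
      next
        fix x assume x: "x \<in> ?T \<inter> (\<Inter>i\<in>I. {x \<in> ?T. \<Phi> i x \<in> pre U i})"
        then have "x \<in> ?T" by simp
        from f_cases[OF this] show "x \<in> {x \<in> ?T. f x \<in> U}"
        proof
          assume "\<exists>i\<in>I. \<Phi> i x \<noteq> p i \<and> f x = Some (i, \<Phi> i x)"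
          then obtain i where i: "i \<in> I" "\<Phi> i x \<noteq> p i" by blast
          then have "\<Phi> i x \<in> pre U i" using x by blast
          then show ?thesis using pre_iff[OF i(1) \<open>x \<in> ?T\<close>] i(2) \<open>x \<in> ?T\<close> by simp
        qed (use True \<open>x \<in> ?T\<close> in simp)
      qed
      have eq': "{x \<in> ?T. \<Phi> i x \<in> pre U i} = {x \<in> ?T. f x \<in> U} \<union> (\<Union>j\<in>I - {i}. {x \<in> ?T. \<Phi> j x \<noteq> p j})"
        if "i \<in> I" for i
      proof (intro equalityI subsetI)
        fix x assume "x \<in> {x \<in> ?T. \<Phi> i x \<in> pre U i}"
        then show "x \<in> {x \<in> ?T. f x \<in> U} \<union> (\<Union>j\<in>I - {i}. {x \<in> ?T. \<Phi> j x \<noteq> p j})"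
          using f_cases[of x] pre_iff[OF that, of x] True by (auto split: if_splits)
      next
        fix x assume x: "x \<in> {x \<in> ?T. f x \<in> U} \<union> (\<Union>j\<in>I - {i}. {x \<in> ?T. \<Phi> j x \<noteq> p j})"
        then have "x \<in> ?T" by auto
        then show "x \<in> {x \<in> ?T. \<Phi> i x \<in> pre U i}"
          using x pre_iff[OF that, of x] True disj[OF that, of _ x] by auto
      qed
      show ?thesis
      proof
        assume "openin X {x \<in> ?T. f x \<in> U}"
        then have "openin X {x \<in> ?T. \<Phi> i x \<in> pre U i}" if "i \<in> I" for i
          unfolding eq'[OF that] using out_open by (intro openin_Un openin_Union) auto
        then show "\<forall>i\<in>I. openin (Y i) (pre U i)"
          using open_pre by blast
      next
        assume "\<forall>i\<in>I. openin (Y i) (pre U i)"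
        then have "\<forall>i\<in>I. openin X {x \<in> ?T. \<Phi> i x \<in> pre U i}" using open_pre by blast
        then show "openin X {x \<in> ?T. f x \<in> U}"
          unfolding eq by (intro openin_Int_Inter) (use I in auto)
      qed
    next
      case False
      have eq: "{x \<in> ?T. f x \<in> U} = (\<Union>i\<in>I. {x \<in> ?T. \<Phi> i x \<in> pre U i})"
      proof (intro equalityI subsetI)
        fix x assume "x \<in> {x \<in> ?T. f x \<in> U}"
        then show "x \<in> (\<Union>i\<in>I. {x \<in> ?T. \<Phi> i x \<in> pre U i})"
          using f_cases[of x] pre_iff[of _ x] False by auto
      next
        fix x assume x: "x \<in> (\<Union>i\<in>I. {x \<in> ?T. \<Phi> i x \<in> pre U i})"
        then show "x \<in> {x \<in> ?T. f x \<in> U}"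
          using pre_iff[of _ x] False by (auto split: if_splits)
      qed
      have eq': "{x \<in> ?T. \<Phi> i x \<in> pre U i} = {x \<in> ?T. f x \<in> U} \<inter> {x \<in> ?T. \<Phi> i x \<noteq> p i}" if "i \<in> I" for i
      proof (rule Set.set_eqI)
        fix x
        show "x \<in> {x \<in> ?T. \<Phi> i x \<in> pre U i} \<longleftrightarrow> x \<in> {x \<in> ?T. f x \<in> U} \<inter> {x \<in> ?T. \<Phi> i x \<noteq> p i}"
          using pre_iff[OF that, of x] False by (cases "\<Phi> i x = p i") auto
      qed
      show ?thesis
      proof
        assume "openin X {x \<in> ?T. f x \<in> U}"
        then have "openin X {x \<in> ?T. \<Phi> i x \<in> pre U i}" if "i \<in> I" for i
          unfolding eq'[OF that] using out_open[OF that] by (rule openin_Int)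
        then show "\<forall>i\<in>I. openin (Y i) (pre U i)"
          using open_pre by blast
      next
        assume "\<forall>i\<in>I. openin (Y i) (pre U i)"
        then show "openin X {x \<in> ?T. f x \<in> U}"
          unfolding eq using open_pre by (intro openin_Union) blast
      qed
    qed
  qed
  then show ?thesis
    unfolding quotient_map_def using im by (auto simp: topspace_wedge openin_wedge pre_def)
qed

section \<open>Collapsing the cone\<close>

abbreviation vsupp :: "('a \<Rightarrow> real) \<Rightarrow> 'a set" where
  "vsupp x \<equiv> {v. x v \<noteq> 0}"

lemma continuous_on_coordinate [continuous_intros]: "continuous_on S (\<lambda>x. x v)"
  by (rule continuous_on_subset[OF continuous_on_product_coordinates]) simp

lemma continuous_on_Min_image:
  fixes f :: "'b \<Rightarrow> 'c::topological_space \<Rightarrow> real"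
  assumes "finite F" "F \<noteq> {}" "\<And>v. v \<in> F \<Longrightarrow> continuous_on S (f v)"
  shows "continuous_on S (\<lambda>x. Min ((\<lambda>v. f v x) ` F))"
  using assms
proof (induction F rule: finite_ne_induct)
  case (insert v F)
  have "(\<lambda>x. Min ((\<lambda>v. f v x) ` insert v F)) = (\<lambda>x. min (f v x) (Min ((\<lambda>v. f v x) ` F)))"
    using insert.hyps by (simp add: fun_eq_iff)
  then show ?case
    using insert by (auto intro!: continuous_on_min)
qed simp

lemma realizationD:
  assumes "x \<in> geom_realization K"
  shows "0 \<le> x v" "vsupp x \<in> K" "finite S \<Longrightarrow> vsupp x \<subseteq> S \<Longrightarrow> sum x S = 1"
proof -
  show "0 \<le> x v" "vsupp x \<in> K" using assms by (auto simp: geom_realization_def)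
  assume "finite S" "vsupp x \<subseteq> S"
  then have "sum x (vsupp x) = sum x S"
    by (intro sum.mono_neutral_left) auto
  then show "sum x S = 1" using assms by (simp add: geom_realization_def)
qed

section \<open>Compactness of the realization, and depth inside a face\<close>

context cone_with_facets
begin

abbreviation realization :: "('a \<Rightarrow> real) set" where
  "realization \<equiv> geom_realization K"

lemma realizationI:
  assumes "\<And>v. 0 \<le> x v" "vsupp x \<subseteq> S" "S \<in> K" "sum x S = 1"
  shows "x \<in> realization"
proof -
  have eq: "sum x (vsupp x) = 1"
    using assms(2,4) finite_face[OF assms(3)] by (subst sum.mono_neutral_left) auto
  then have "vsupp x \<noteq> {}" by (metis sum.empty zero_neq_one)
  then show ?thesis
    using assms eq subface[OF assms(3,2)] by (simp add: geom_realization_def)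
qed

lemma finite_vertices: "finite (\<Union>K)"
  using finite_complex finite_face by blast

text \<open>A finite union of closed simplices, each closed in a product of compact sets. The vertex
  type may be infinite, so the coordinates outside the face are confined to \<open>{0}\<close> and
  Tychonoff's theorem applies.\<close>

lemma compact_realization: "compact realization"
proof -
  define B where "B F = PiE UNIV (\<lambda>v. if v \<in> F then {0..1} else {0 :: real})" for F :: "'a set"
  have B: "compact (B F)" for F
  proof -
    have "compactin (powertop_real UNIV) (B F)"
      unfolding B_def compactin_PiE by (auto simp: compactin_euclidean_iff)
    then show ?thesis by (simp add: euclidean_product_topology compactin_euclidean_iff)
  qed
  have "realization = (\<Union>F\<in>K. B F \<inter> {x. sum x F = 1})"
  proof (intro equalityI subsetI)
    fix x assume x: "x \<in> realization"
    let ?F = "vsupp x"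
    have F: "?F \<in> K" "finite ?F" "sum x ?F = 1"
      using realizationD[OF x] finite_face by auto
    have "x v \<le> 1" if "v \<in> ?F" for v
      using member_le_sum[of v ?F x] that F realizationD(1)[OF x] by auto
    then have "x \<in> B ?F"
      using realizationD(1)[OF x] by (auto simp: B_def)
    then show "x \<in> (\<Union>F\<in>K. B F \<inter> {x. sum x F = 1})" using F by auto
  next
    fix x assume "x \<in> (\<Union>F\<in>K. B F \<inter> {x. sum x F = 1})"
    then obtain F where F: "F \<in> K" "x \<in> B F" "sum x F = 1" by auto
    have "x v \<in> (if v \<in> F then {0..1} else {0})" for v
      using F(2) unfolding B_def by (rule PiE_mem) simp
    then have "0 \<le> x v" "x v \<noteq> 0 \<Longrightarrow> v \<in> F" for v
      by (smt (verit) atLeastAtMost_iff singletonD)+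
    then show "x \<in> realization" using F by (intro realizationI[of x F]) auto
  qed
  moreover have "closed {x :: 'a \<Rightarrow> real. sum x F = 1}" for F
    by (intro closed_Collect_eq continuous_intros)
  ultimately show ?thesis
    using B finite_complex by (auto intro!: compact_UN compact_Int_closed)
qed

text \<open>For a facet, a continuous measure of the distance from its boundary, defined on the
  whole realization and zero off the open facet. It permits formulas without a case distinction on
  the support.\<close>

definition depth :: "'a set \<Rightarrow> ('a \<Rightarrow> real) \<Rightarrow> real" where
  "depth F x = Min (x ` F)"

lemma continuous_on_depth: "F \<in> K \<Longrightarrow> continuous_on S (depth F)"
  unfolding depth_def using finite_face nonempty_face
  by (intro continuous_on_Min_image continuous_on_coordinate) auto

lemma depth_le: "F \<in> K \<Longrightarrow> v \<in> F \<Longrightarrow> depth F x \<le> x v"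
  using finite_face by (simp add: depth_def)

lemma depth_attained: "F \<in> K \<Longrightarrow> \<exists>v\<in>F. x v = depth F x"
  using finite_face nonempty_face Min_in[of "x ` F"] by (fastforce simp: depth_def)

lemma depth_nonneg: "F \<in> K \<Longrightarrow> x \<in> realization \<Longrightarrow> 0 \<le> depth F x"
  using finite_face nonempty_face realizationD(1)[of x K] by (simp add: depth_def)

text \<open>Positive depth by itself says only that \<open>F\<close> lies in the support; maximality
  of the facet turns this into equality.\<close>

lemma depth_pos_iff:
  assumes "F \<in> facets" "x \<in> realization"
  shows "0 < depth F x \<longleftrightarrow> vsupp x = F"
proof
  assume "0 < depth F x"
  then have "F \<subseteq> vsupp x"
    using depth_le[of F _ x] facet_face[OF assms(1)] by force
  then show "vsupp x = F"
    using facet_maximal[OF assms(1) realizationD(2)[OF assms(2)]] by simp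
next
  assume s: "vsupp x = F"
  obtain v where "v \<in> F" "x v = depth F x" using depth_attained facet_face assms(1) by blast
  then show "0 < depth F x"
    using s realizationD(1)[OF assms(2), of v] by force
qed

lemma depth_eq_0_iff:
  assumes "F \<in> facets" "x \<in> realization"
  shows "depth F x = 0 \<longleftrightarrow> vsupp x \<noteq> F"
  using depth_pos_iff[OF assms] depth_nonneg[OF facet_face[OF assms(1)] assms(2)] by linarith

section \<open>Open facets as punctured spheres\<close>

definition label :: "'a set \<Rightarrow> nat \<Rightarrow> 'a" where
  "label F = (SOME e. bij_betw e {..<card F} F)"

lemma bij_label: "F \<in> K \<Longrightarrow> bij_betw (label F) {..<card F} F"
  unfolding label_def
  using ex_bij_betw_nat_finite[OF finite_face, of F] unfolding atLeast0LessThan by (rule someI_ex)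

lemma label_surj:
  assumes "F \<in> K" "v \<in> F"
  obtains k where "k < card F" "v = label F k"
  using bij_label[OF assms(1)] assms(2) by (auto simp: bij_betw_def)

lemma label_in: "F \<in> K \<Longrightarrow> k < card F \<Longrightarrow> label F k \<in> F"
  using bij_label[of F] by (auto simp: bij_betw_def)

lemma card_face_pos: "F \<in> K \<Longrightarrow> 0 < card F"
  using finite_face nonempty_face by (simp add: card_gt_0_iff)

text \<open>On the open simplex \<open>F\<close>, with \<open>m\<close> the depth of \<open>x\<close>, the coordinates \<open>offset F x k / m\<close> with
  \<open>k \<ge> 1\<close> identify the simplex with Euclidean space, and \<open>collapse F\<close> is the inverse of the
  stereographic projection in these coordinates, with denominators cleared. The term
  \<open>(1 - sum x F)\<^sup>2\<close> of \<open>den\<close> keeps the denominator positive on the whole realization; outside the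
  open simplex the depth is \<open>0\<close>, which gives the base point.\<close>

definition offset :: "'a set \<Rightarrow> ('a \<Rightarrow> real) \<Rightarrow> nat \<Rightarrow> real" where
  "offset F x k = x (label F k) - x (label F 0)"

definition den :: "'a set \<Rightarrow> ('a \<Rightarrow> real) \<Rightarrow> real" where
  "den F x = (\<Sum>k<card F. (offset F x k)\<^sup>2) + (1 - sum x F)\<^sup>2 + (depth F x)\<^sup>2"

definition collapse :: "'a set \<Rightarrow> ('a \<Rightarrow> real) \<Rightarrow> nat \<Rightarrow> real" where
  "collapse F x k = (if k = 0 then 1 - 2 * (depth F x)\<^sup>2 / den F x
     else if k < card F then 2 * depth F x * offset F x k / den F x else 0)"

text \<open>If all the squares vanish, the coordinates on \<open>F\<close> are equal and their
  minimum is 0, so they sum to 0, whereas the middle square forces the sum 1.\<close>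

lemma den_pos:
  assumes "F \<in> K"
  shows "0 < den F x"
proof (rule ccontr)
  have S: "0 \<le> (\<Sum>k<card F. (offset F x k)\<^sup>2)" by (simp add: sum_nonneg)
  assume "\<not> 0 < den F x"
  then have eqs: "(\<Sum>k<card F. (offset F x k)\<^sup>2) = 0" "(1 - sum x F)\<^sup>2 = 0" "(depth F x)\<^sup>2 = 0"
    using S zero_le_power2[of "1 - sum x F"] zero_le_power2[of "depth F x"] unfolding den_def by linarith+
  have "offset F x k = 0" if "k < card F" for k
    using eqs(1) that by (simp add: sum_nonneg_eq_0_iff)
  then have "x v = x (label F 0)" if "v \<in> F" for v
    using label_surj[OF assms that] by (metis offset_def right_minus_eq)
  moreover obtain w where "w \<in> F" "x w = depth F x" using depth_attained assms by blast
  ultimately have "x v = 0" if "v \<in> F" for v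
    using eqs(3) that by (metis zero_eq_power2)
  then show False using eqs(2) by simp
qed

lemma sum_lessThan_split_0: "0 < n \<Longrightarrow> (\<Sum>k<n. g k) = g 0 + (\<Sum>k\<in>{1..<n}. g (k::nat) :: real)"
  by (simp add: lessThan_atLeast0 sum.atLeast_Suc_lessThan)

lemma topspace_nsphere_card:
  assumes "F \<in> K"
  shows "y \<in> topspace (nsphere (card F - 1)) \<longleftrightarrow> (\<Sum>k<card F. (y k)\<^sup>2) = 1 \<and> (\<forall>k\<ge>card F. y k = 0)"
proof -
  have "{..card F - 1} = {..<card F}" "\<And>k. card F - 1 < k \<longleftrightarrow> card F \<le> k"
    using card_face_pos[OF assms] by auto
  then show ?thesis by (simp add: nsphere)
qed

text \<open>With \<open>D = m\<^sup>2 + A\<close>, this is the identity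
  \<open>(D - 2 * m\<^sup>2)\<^sup>2 + 4 * m\<^sup>2 * A = D\<^sup>2\<close> behind stereographic
  projection.\<close>

lemma collapse_in_sphere:
  assumes F: "F \<in> facets" and x: "x \<in> realization"
  shows "collapse F x \<in> topspace (nsphere (card F - 1))"
proof -
  have FK: "F \<in> K" using F by (rule facet_face)
  let ?m = "depth F x" and ?D = "den F x" and ?A = "\<Sum>k<card F. (offset F x k)\<^sup>2"
  have D: "?D > 0" by (rule den_pos[OF FK])
  \<comment> \<open>Either the depth is 0, or the point lies in the open facet and the term
    \<open>(1 - sum x F)\<^sup>2\<close> drops out of \<open>den\<close>. The product form treats
    both at once.\<close>
  have me: "?m\<^sup>2 * (?D - ?m\<^sup>2 - ?A) = 0"
  proof (cases "?m = 0")
    case False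
    then have "vsupp x = F" using depth_eq_0_iff[OF F x] by blast
    then have "sum x F = 1" using realizationD(3)[OF x finite_face[OF FK]] by simp
    then show ?thesis by (simp add: den_def)
  qed simp
  have "(\<Sum>k<card F. (collapse F x k)\<^sup>2) = (1 - 2 * ?m\<^sup>2 / ?D)\<^sup>2 + (\<Sum>k\<in>{1..<card F}. (2 * ?m * offset F x k / ?D)\<^sup>2)"
    unfolding sum_lessThan_split_0[OF card_face_pos[OF FK]] by (simp add: collapse_def)
  also have "(\<Sum>k\<in>{1..<card F}. (2 * ?m * offset F x k / ?D)\<^sup>2) = 4 * ?m\<^sup>2 / ?D\<^sup>2 * ?A"
    unfolding sum_lessThan_split_0[OF card_face_pos[OF FK]] sum_distrib_left
    by (simp add: offset_def power_mult_distrib power_divide sum_distrib_left)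
  also have "(1 - 2 * ?m\<^sup>2 / ?D)\<^sup>2 + 4 * ?m\<^sup>2 / ?D\<^sup>2 * ?A = 1 - 4 * (?m\<^sup>2 * (?D - ?m\<^sup>2 - ?A)) / ?D\<^sup>2"
    using D by (simp add: power2_eq_square field_simps)
  finally have "(\<Sum>k<card F. (collapse F x k)\<^sup>2) = 1"
    unfolding me by simp
  then show ?thesis
    unfolding topspace_nsphere_card[OF FK] using card_face_pos[OF FK] by (simp add: collapse_def)
qed

lemma continuous_collapse:
  assumes F: "F \<in> facets"
  shows "continuous_map (top_of_set realization) (nsphere (card F - 1)) (collapse F)"
proof -
  have FK: "F \<in> K" using F by (rule facet_face)
  have o: "continuous_on realization (\<lambda>x. offset F x k)" for k
    unfolding offset_def by (intro continuous_intros)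
  have d: "continuous_on realization (den F)"
    unfolding den_def by (intro continuous_intros o continuous_on_depth[OF FK])
  have "continuous_on realization (\<lambda>x. collapse F x k)" for k
    unfolding collapse_def using den_pos[OF FK]
    by (cases "k = 0"; cases "k < card F")
      (auto intro!: continuous_intros o d continuous_on_depth[OF FK] simp: less_imp_neq[symmetric])
  then have "continuous_on realization (collapse F)"
    by (rule continuous_on_coordinatewise_then_product)
  then have "continuous_map (top_of_set realization) (powertop_real UNIV) (collapse F)"
    by (simp add: euclidean_product_topology)
  then show ?thesis
    using collapse_in_sphere[OF F] topspace_nsphere_card[OF FK]
    unfolding nsphere by (auto simp: continuous_map_in_subtopology nsphere)
qed

lemma collapse_eq_base_iff:
  assumes "F \<in> K"
  shows "collapse F x = sphere_basepoint \<longleftrightarrow> depth F x = 0"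
proof
  assume "collapse F x = sphere_basepoint"
  then have "collapse F x 0 = sphere_basepoint 0" by simp
  then show "depth F x = 0"
    using den_pos[OF assms, of x] by (simp add: collapse_def sphere_basepoint_def)
qed (auto simp: collapse_def sphere_basepoint_def)

text \<open>Coordinate 0 determines \<open>r\<close>, and with it the other coordinates determine
  the offsets divided by the depth. Divided by the depth, the coordinates have minimum 1, which
  fixes the reference coordinate; the total sum 1 then fixes the depth.\<close>

lemma collapse_inj:
  assumes F: "F \<in> facets" and x: "x \<in> realization" "0 < depth F x" and y: "y \<in> realization" "0 < depth F y"
    and eq: "collapse F x = collapse F y"
  shows "x = y"
proof -
  have FK: "F \<in> K" using F by (rule facet_face)
  define r where "r x = (depth F x)\<^sup>2 / den F x" for x
  have r: "r x = r y" "r x > 0"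
    using fun_cong[OF eq, of 0] den_pos[OF FK] x by (auto simp: collapse_def r_def)
  have off: "offset F z k / depth F z * r z = depth F z * offset F z k / den F z" if "0 < depth F z" for z k
    using that by (simp add: r_def power2_eq_square)
  have "offset F x k / depth F x = offset F y k / depth F y" if "k < card F" for k
  proof (cases "k = 0")
    case False
    then have "depth F x * offset F x k / den F x = depth F y * offset F y k / den F y"
      using fun_cong[OF eq, of k] that by (simp add: collapse_def)
    then have "offset F x k / depth F x * r x = offset F y k / depth F y * r x"
      using off[OF x(2), of k] off[OF y(2), of k] r(1) by simp
    moreover have "r x \<noteq> 0" using r(2) by simp
    ultimately show ?thesis by (simp only: mult_cancel_right simp_thms)
  qed (simp add: offset_def)
  then have *: "(x v - x (label F 0)) / depth F x = (y v - y (label F 0)) / depth F y" if "v \<in> F" for v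
    using label_surj[OF FK that] by (metis offset_def)
  \<comment> \<open>Compare both points at a vertex where \<open>b\<close> is minimal: there the
    scaled coordinate of \<open>b\<close> is 1 and that of \<open>c\<close> is at least 1. The
    converse inequality follows by exchanging the points.\<close>
  have le: "b (label F 0) / depth F b \<le> c (label F 0) / depth F c"
    if "0 < depth F b" "0 < depth F c"
      and h: "\<And>v. v \<in> F \<Longrightarrow> (c v - c (label F 0)) / depth F c = (b v - b (label F 0)) / depth F b" for b c
  proof -
    obtain v where v: "v \<in> F" "b v = depth F b" using depth_attained[OF FK, of b] by blast
    have "c v / depth F c \<ge> 1" using depth_le[OF FK v(1), of c] that by simp
    moreover have "c v / depth F c - c (label F 0) / depth F c = 1 - b (label F 0) / depth F b"
      using h[OF v(1)] v(2) that(1) by (simp add: diff_divide_distrib)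
    ultimately show ?thesis by linarith
  qed
  have "x (label F 0) / depth F x = y (label F 0) / depth F y"
    using le[OF x(2) y(2) *[symmetric]] le[OF y(2) x(2) *] by (rule antisym)
  then have ratio: "x v / depth F x = y v / depth F y" if "v \<in> F" for v
    using *[OF that] by (simp add: diff_divide_distrib)
  have s: "vsupp x = F" "vsupp y = F" using depth_pos_iff F x y by auto
  then have "sum x F = 1" "sum y F = 1"
    using realizationD(3) x(1) y(1) finite_face[OF FK] by blast+
  moreover have "(\<Sum>v\<in>F. x v / depth F x) = (\<Sum>v\<in>F. y v / depth F y)"
    using ratio by (intro sum.cong) auto
  ultimately have "1 / depth F x = 1 / depth F y"
    by (simp add: sum_divide_distrib[symmetric])
  then have "x v = y v" if "v \<in> F" for v
    using ratio[OF that] x(2) by simp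
  moreover have "x v = y v" if "v \<notin> F" for v
  proof -
    have "x v = 0" "y v = 0" using that s by blast+
    then show ?thesis by simp
  qed
  ultimately show ?thesis by blast
qed

lemma vertex_realization:
  assumes "{v} \<in> K"
  shows "(\<lambda>w. if w = v then 1 else 0) \<in> realization"
  using assms by (intro realizationI[of _ "{v}"]) auto

lemma collapse_surj:
  assumes F: "F \<in> facets" and y: "y \<in> topspace (nsphere (card F - 1))"
  shows "\<exists>x\<in>realization. collapse F x = y"
proof (cases "y = sphere_basepoint")
  case True
  let ?e = "\<lambda>w. if w = a then 1 else 0 :: real"
  have e: "?e \<in> realization" by (rule vertex_realization[OF apex])
  have "vsupp ?e = {a}" by auto
  then have "depth F ?e = 0"
    using apex_notin_facet[OF F] depth_eq_0_iff[OF F e] by auto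
  then show ?thesis
    using e True collapse_eq_base_iff[OF facet_face[OF F]] by blast
next
  case False
  have FK: "F \<in> K" using F by (rule facet_face)
  have fin: "finite F" using finite_face[OF FK] .
  have n: "0 < card F" by (rule card_face_pos[OF FK])
  have y1: "(\<Sum>k<card F. (y k)\<^sup>2) = 1" and y0: "\<And>k. k \<ge> card F \<Longrightarrow> y k = 0"
    using y unfolding topspace_nsphere_card[OF FK] by blast+
  have ysplit: "(y 0)\<^sup>2 + (\<Sum>k\<in>{1..<card F}. (y k)\<^sup>2) = 1"
    using y1 unfolding sum_lessThan_split_0[OF n] .
  have lt1: "y 0 < 1"
  proof (rule ccontr)
    assume "\<not> y 0 < 1"
    then have ge: "1 \<le> (y 0)\<^sup>2" using power_mono[of 1 "y 0" 2] by simp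
    have nn: "0 \<le> (\<Sum>k\<in>{1..<card F}. (y k)\<^sup>2)" by (simp add: sum_nonneg)
    have z: "(\<Sum>k\<in>{1..<card F}. (y k)\<^sup>2) = 0" and "(y 0)\<^sup>2 = 1"
      using ysplit ge nn by linarith+
    then have "y 0 = 1" using \<open>\<not> y 0 < 1\<close> by (auto simp: power2_eq_1_iff)
    moreover have "y k = 0" if "k \<noteq> 0" for k
    proof (cases "k < card F")
      case True
      then show ?thesis using z that by (auto simp: sum_nonneg_eq_0_iff)
    qed (use y0 in simp)
    ultimately have "y = sphere_basepoint" by (auto simp: sphere_basepoint_def)
    then show False using False by simp
  qed
  define idx where "idx = inv_into {..<card F} (label F)"
  have idx: "idx (label F k) = k" if "k < card F" for k
    using bij_label[OF FK] that by (simp add: idx_def bij_betw_def)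
  \<comment> \<open>Stereographic projection of \<open>y\<close> from the base point, which is why
    \<open>y 0 < 1\<close> was needed. The reference vertex gets the value 0.\<close>
  define u where "u v = (if idx v = 0 then 0 else y (idx v) / (1 - y 0))" for v
  define c where "c = Min (u ` F)"
  have c: "c \<le> u v" if "v \<in> F" for v using that fin by (simp add: c_def)
  obtain v0 where v0: "v0 \<in> F" "u v0 = c"
    using Min_in[of "u ` F"] fin nonempty_face[OF FK] by (fastforce simp: c_def)
  define N where "N = (\<Sum>v\<in>F. u v - c + 1)"
  have N: "N > 0"
    unfolding N_def using fin nonempty_face[OF FK] c by (intro sum_pos) force+
  \<comment> \<open>The shift by \<open>1 - c\<close> makes the least value 1, so after
    normalization the depth is \<open>1 / N\<close> and offset over depth gives back
    \<open>u\<close>.\<close>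
  define x where "x v = (if v \<in> F then (u v - c + 1) / N else 0)" for v
  have x: "x \<in> realization"
  proof (rule realizationI[of x F])
    show "0 \<le> x v" for v using c[of v] N by (simp add: x_def)
    show "sum x F = 1" using N by (simp add: x_def sum_divide_distrib[symmetric] N_def)
  qed (use FK in \<open>auto simp: x_def\<close>)
  have depth: "depth F x = 1 / N"
    unfolding depth_def
  proof (rule Min_eqI)
    show "1 / N \<in> x ` F" using v0 by (intro image_eqI[of _ _ v0]) (auto simp: x_def)
    show "1 / N \<le> w" if "w \<in> x ` F" for w
      using that c N by (auto simp: x_def intro!: divide_right_mono)
  qed (use fin in simp)
  have lab: "label F k \<in> F" if "k < card F" for k
    using label_in[OF FK that] .
  have u_lab: "u (label F k) = (if k = 0 then 0 else y k / (1 - y 0))" if "k < card F" for k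
    using idx[OF that] by (simp add: u_def)
  have offset: "offset F x k = (if k = 0 then 0 else y k / (1 - y 0)) / N" if "k < card F" for k
    using u_lab[OF that] u_lab[OF n] lab[OF that] lab[OF n]
    by (simp add: offset_def x_def diff_divide_distrib[symmetric])
  have sum1: "sum x F = 1"
    by (rule realizationD(3)[OF x fin]) (auto simp: x_def)
  have "(\<Sum>k<card F. (offset F x k)\<^sup>2) = (\<Sum>k\<in>{1..<card F}. (y k)\<^sup>2) / ((1 - y 0)\<^sup>2 * N\<^sup>2)"
    unfolding sum_lessThan_split_0[OF n] sum_divide_distrib
    using offset n by (simp add: power_divide power_mult_distrib)
  also have "(\<Sum>k\<in>{1..<card F}. (y k)\<^sup>2) = (1 - y 0) * (1 + y 0)"
    using ysplit by (simp add: power2_eq_square algebra_simps)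
  finally have "(\<Sum>k<card F. (offset F x k)\<^sup>2) = (1 + y 0) / ((1 - y 0) * N\<^sup>2)"
    using lt1 by (simp add: power2_eq_square)
  then have "den F x = (1 + y 0) / ((1 - y 0) * N\<^sup>2) + 1 / N\<^sup>2"
    unfolding den_def sum1 depth by (simp add: power_divide)
  also have "\<dots> = 2 / ((1 - y 0) * N\<^sup>2)"
    using lt1 N by (simp add: field_simps)
  finally have den: "den F x = 2 / ((1 - y 0) * N\<^sup>2)" .
  have "collapse F x k = y k" for k
  proof -
    consider "k = 0" | "k \<noteq> 0" "k < card F" | "k \<noteq> 0" "k \<ge> card F" by linarith
    then show ?thesis
    proof cases
      case 1
      then show ?thesis using lt1 N by (simp add: collapse_def den depth power_divide field_simps)
    next
      case 2
      then show ?thesis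
        using lt1 N offset[OF 2(2)] by (simp add: collapse_def den depth power2_eq_square)
    next
      case 3
      then show ?thesis using y0 by (simp add: collapse_def)
    qed
  qed
  then show ?thesis using x by blast
qed

section \<open>A deformation that contracts the cone\<close>

text \<open>A homotopy from the identity to a map that contracts the cone to its apex. A point in the
  interior of a facet is first pushed away from the barycentre, by subtracting \<open>inset\<close> from its
  coordinates and normalizing. Only when it has reached the boundary, which lies in the
  cone, does \<open>coning\<close> become positive and move it towards the apex.\<close>

definition inset :: "'a set \<Rightarrow> real \<Rightarrow> ('a \<Rightarrow> real) \<Rightarrow> real" where
  "inset F t x = min (depth F x) (t / (2 * card (\<Union>K)))"

definition coning :: "real \<Rightarrow> ('a \<Rightarrow> real) \<Rightarrow> real" where
  "coning t x = max 0 (t - 2 * card (\<Union>K) * (\<Sum>F\<in>facets. depth F x))"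

text \<open>The sums over all facets make continuity evident; at each point at most the summand of
  the facet that is its support is nonzero. The denominator is the coordinate sum that remains after
  the subtraction.\<close>

definition deflate :: "real \<times> ('a \<Rightarrow> real) \<Rightarrow> 'a \<Rightarrow> real" where
  "deflate p v =
     (1 - coning (fst p) (snd p)) * (snd p v - (\<Sum>F | F \<in> facets \<and> v \<in> F. inset F (fst p) (snd p))) /
       (1 - (\<Sum>F\<in>facets. card F * inset F (fst p) (snd p))) +
     coning (fst p) (snd p) * (if v = a then 1 else 0)"

lemma card_vertices: "F \<in> K \<Longrightarrow> 0 < card (\<Union>K) \<and> card F \<le> card (\<Union>K)"
  using card_face_pos[of F] card_mono[OF finite_vertices, of F] by force

lemma depth_other:
  assumes "x \<in> realization" "F \<in> facets" "F \<noteq> vsupp x"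
  shows "depth F x = 0" "0 \<le> t \<Longrightarrow> inset F t x = 0"
proof -
  show d: "depth F x = 0" using assms depth_eq_0_iff by blast
  show "0 \<le> t \<Longrightarrow> inset F t x = 0" by (simp add: inset_def d)
qed

text \<open>Off the open facets all depths are 0, hence \<open>coning t x = t\<close> and only the
  straight-line contraction to the apex remains. At \<open>t = 1\<close> it no longer depends on
  \<open>x\<close>.\<close>

lemma deflate_star:
  assumes x: "x \<in> realization" "vsupp x \<notin> facets" and t: "0 \<le> t"
  shows "deflate (t, x) = (\<lambda>v. (1 - t) * x v + (if v = a then t else 0))"
    and "(\<Sum>F\<in>facets. card F * inset F t x) = 0"
proof -
  have other: "depth F x = 0" "inset F t x = 0" if "F \<in> facets" for F
    using depth_other[OF x(1) that] x(2) that t by auto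
  show "(\<Sum>F\<in>facets. card F * inset F t x) = 0" using other by simp
  moreover have "(\<Sum>F | F \<in> facets \<and> v \<in> F. inset F t x) = 0" for v using other by simp
  moreover have "coning t x = t" using other t by (simp add: coning_def)
  ultimately show "deflate (t, x) = (\<lambda>v. (1 - t) * x v + (if v = a then t else 0))"
    by (auto simp: deflate_def fun_eq_iff)
qed

lemma deflate_facet:
  assumes x: "x \<in> realization" "vsupp x = F" and F: "F \<in> facets" and t: "0 \<le> t"
  shows "deflate (t, x) v = (1 - coning t x) * (x v - (if v \<in> F then inset F t x else 0)) /
      (1 - card F * inset F t x) + (if v = a then coning t x else 0)"
    and "(\<Sum>F\<in>facets. card F * inset F t x) = card F * inset F t x"
    and "coning t x = max 0 (t - 2 * card (\<Union>K) * depth F x)"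
proof -
  have single: "(\<Sum>G | G \<in> facets \<and> P G. g G) = (if P F then g F else 0 :: real)"
    if "\<And>G. G \<in> facets \<Longrightarrow> G \<noteq> F \<Longrightarrow> g G = 0" for P and g :: "'a set \<Rightarrow> real"
  proof -
    have "(\<Sum>G | G \<in> facets \<and> P G. g G) = (\<Sum>G | G \<in> facets \<and> P G. if G = F then g F else 0)"
      using that by (intro sum.cong) auto
    then show ?thesis using F finite_facets by (simp add: sum.delta)
  qed
  have other: "depth G x = 0" "inset G t x = 0" if "G \<in> facets" "G \<noteq> F" for G
    using depth_other[OF x(1) that(1)] x(2) that(2) t by auto
  show s: "(\<Sum>G\<in>facets. card G * inset G t x) = card F * inset F t x"
    using single[of "\<lambda>G. card G * inset G t x" "\<lambda>_. True"] other by simp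
  have s': "(\<Sum>G | G \<in> facets \<and> v \<in> G. inset G t x) = (if v \<in> F then inset F t x else 0)"
    by (rule single) (rule other)
  show "coning t x = max 0 (t - 2 * card (\<Union>K) * depth F x)"
    using single[of "\<lambda>G. depth G x" "\<lambda>_. True"] other by (simp add: coning_def)
  show "deflate (t, x) v = (1 - coning t x) * (x v - (if v \<in> F then inset F t x else 0)) /
      (1 - card F * inset F t x) + (if v = a then coning t x else 0)"
    unfolding deflate_def fst_conv snd_conv s s' by simp
qed

text \<open>The reason for the cap \<open>t / (2 * card (\<Union>K))\<close>: a face has at most
  \<open>card (\<Union>K)\<close> vertices, so at most half of the total weight is removed and
  normalizing is safe.\<close>

lemma inset_bounds:
  assumes "F \<in> K" "x \<in> realization" "0 \<le> t" "t \<le> 1"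
  shows "0 \<le> inset F t x" "inset F t x \<le> depth F x" "card F * inset F t x \<le> 1 / 2"
proof -
  show "0 \<le> inset F t x" "inset F t x \<le> depth F x"
    using depth_nonneg assms by (auto simp: inset_def)
  have "inset F t x \<le> 1 / (2 * card (\<Union>K))"
    using assms(4) by (auto simp: inset_def min_def divide_right_mono intro: order_trans)
  then have "card F * inset F t x \<le> card F * (1 / (2 * card (\<Union>K)))"
    by (rule mult_left_mono) simp
  also have "\<dots> \<le> 1 / 2"
    using card_vertices[OF assms(1)] by (simp add: field_simps)
  finally show "card F * inset F t x \<le> 1 / 2" .
qed

lemma deflate_den:
  assumes "x \<in> realization" "0 \<le> t" "t \<le> 1"
  shows "(\<Sum>F\<in>facets. card F * inset F t x) \<le> 1 / 2"
proof (cases "vsupp x \<in> facets")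
  case True
  then show ?thesis
    using deflate_facet(2)[OF assms(1) refl True assms(2)] inset_bounds(3)[OF facet_face assms] by simp
qed (use deflate_star(2) assms in simp)

text \<open>For a point of an open facet \<open>F\<close>, the question is which face carries the
  image, since \<open>insert a F\<close> is not one. While \<open>coning\<close> is 0, it is
  \<open>F\<close>. Once it is positive, the coordinate at a vertex \<open>w\<close> of least weight
  has become 0, and \<open>insert a (F - {w})\<close> is a face.\<close>

lemma deflate_in_realization:
  assumes x: "x \<in> realization" and t: "0 \<le> t" "t \<le> 1"
  shows "deflate (t, x) \<in> realization"
proof (cases "vsupp x \<in> facets")
  case False
  let ?S = "insert a (vsupp x)"
  have S: "?S \<in> K" using realizationD(2)[OF x] False by (rule cone_face)
  then have fin: "finite ?S" by (rule finite_face)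
  have "(\<Sum>v\<in>?S. (1 - t) * x v + (if v = a then t else 0)) = (1 - t) * sum x ?S + t"
    using fin by (simp only: sum.distrib sum_distrib_left sum.delta insertI1 if_True)
  also have "sum x ?S = 1" by (rule realizationD(3)[OF x fin]) auto
  finally show ?thesis
    unfolding deflate_star(1)[OF x False t(1)]
    using S t realizationD(1)[OF x] by (intro realizationI[of _ ?S]) auto
next
  case True
  define F c s where "F = vsupp x" and "c = inset F t x" and "s = coning t x"
  have F: "F \<in> facets" "F \<in> K" and fin: "finite F" and aF: "a \<notin> F"
    using True facet_face finite_face apex_notin_facet by (auto simp: F_def)
  have c: "0 \<le> c" "c \<le> depth F x" "card F * c \<le> 1 / 2"
    unfolding c_def using inset_bounds[OF F(2) x t] by auto
  have s_eq: "s = max 0 (t - 2 * card (\<Union>K) * depth F x)"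
    unfolding s_def by (rule deflate_facet(3)[OF x F_def[symmetric] F(1) t(1)])
  have "0 \<le> 2 * card (\<Union>K) * depth F x" using depth_nonneg[OF F(2) x] by simp
  then have "t - 2 * card (\<Union>K) * depth F x \<le> 1" using t by linarith
  then have s: "0 \<le> s" "s \<le> 1" unfolding s_eq by simp_all
  let ?d = "deflate (t, x)"
  have d: "?d v = (1 - s) * (x v - (if v \<in> F then c else 0)) / (1 - card F * c) + (if v = a then s else 0)" for v
    unfolding c_def s_def by (rule deflate_facet(1)[OF x F_def[symmetric] F(1) t(1)])
  have xF: "x v = 0" if "v \<notin> F" for v using that by (simp add: F_def)
  have "sum ?d F = (\<Sum>v\<in>F. (1 - s) / (1 - card F * c) * (x v - c))"
    using aF by (intro sum.cong) (auto simp: d)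
  also have "\<dots> = (1 - s) / (1 - card F * c) * (sum x F - card F * c)"
    unfolding sum_distrib_left[symmetric] sum_subtractf by simp
  also have "sum x F = 1"
    by (rule realizationD(3)[OF x fin]) (simp add: F_def)
  finally have sumF: "sum ?d F = 1 - s" using c by simp
  have da: "?d a = s" using aF xF by (simp add: d)
  have sum: "sum ?d (insert a F) = 1"
    using sumF da fin aF by simp
  have nonneg: "0 \<le> ?d v" for v
    using s c depth_le[OF F(2), of v x] xF by (cases "v \<in> F") (auto simp: d intro!: add_nonneg_nonneg)
  have zero: "?d v = 0" if "v \<notin> insert a F" for v
    using that xF by (simp add: d)
  obtain S where S: "S \<in> K" "S \<subseteq> insert a F" "vsupp ?d \<subseteq> S"
  proof (cases "s = 0")
    case True
    have "vsupp ?d \<subseteq> F"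
    proof
      fix v assume "v \<in> vsupp ?d"
      then show "v \<in> F" using zero[of v] da True by (cases "v = a") auto
    qed
    then show ?thesis using that[of F] F by blast
  next
    case False
    \<comment> \<open>The factor in \<open>coning\<close> matches the cap in \<open>inset\<close>:
      \<open>coning\<close> is positive only when the depth is below the cap, that is, when the
      whole depth has been subtracted.\<close>
    then have "2 * card (\<Union>K) * depth F x < t" by (simp add: s_eq max_def split: if_splits)
    then have c_eq: "c = depth F x"
      using card_vertices[OF F(2)] by (simp add: c_def inset_def field_simps)
    obtain w where w: "w \<in> F" "x w = depth F x" using depth_attained[OF F(2)] by blast
    have "?d w = 0" using w c_eq aF by (auto simp: d)
    then have "vsupp ?d \<subseteq> insert a (F - {w})" using zero by auto
    moreover have "insert a (F - {w}) \<in> K"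
      using w by (intro facet_cone_proper[OF F(1)]) auto
    ultimately show ?thesis using that by blast
  qed
  have "sum ?d S = 1"
    using sum.mono_neutral_left[of "insert a F" S ?d] S fin sum by auto
  then show ?thesis using nonneg S by (intro realizationI[of ?d S])
qed

lemma deflate_0: "x \<in> realization \<Longrightarrow> deflate (0, x) = x"
proof -
  assume x: "x \<in> realization"
  have "depth F x \<ge> 0" if "F \<in> facets" for F using depth_nonneg x facet_face that by blast
  then have "inset F 0 x = 0" if "F \<in> facets" for F using that by (simp add: inset_def)
  moreover have "coning 0 x = 0"
  proof -
    have "0 \<le> (\<Sum>F\<in>facets. depth F x)" using depth_nonneg x facet_face by (simp add: sum_nonneg)
    then have "0 \<le> 2 * card (\<Union>K) * (\<Sum>F\<in>facets. depth F x)" by simp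
    then show ?thesis by (simp add: coning_def)
  qed
  ultimately show ?thesis by (simp add: deflate_def fun_eq_iff)
qed

lemma continuous_deflate:
  "continuous_map (prod_topology (top_of_set {0..1}) (top_of_set realization)) (top_of_set realization) deflate"
proof -
  let ?A = "{0..1::real} \<times> realization"
  have coord: "continuous_on ?A (\<lambda>p. snd p v)" for v
    by (rule continuous_on_compose2[OF continuous_on_coordinate[of UNIV v] continuous_on_snd[OF continuous_on_id]]) auto
  have depth: "continuous_on ?A (\<lambda>p. depth F (snd p))" if "F \<in> facets" for F
    by (rule continuous_on_compose2[OF continuous_on_depth[OF facet_face[OF that], of UNIV] continuous_on_snd[OF continuous_on_id]]) auto
  have inset: "continuous_on ?A (\<lambda>p. inset F (fst p) (snd p))" if "F \<in> facets" for F
    unfolding inset_def by (intro continuous_intros depth that) (use card_vertices[OF facet_face[OF that]] in auto)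
  have coning: "continuous_on ?A (\<lambda>p. coning (fst p) (snd p))"
    unfolding coning_def by (intro continuous_intros depth)
  have "continuous_on ?A (\<lambda>p. deflate p v)" for v
    unfolding deflate_def
  proof (intro continuous_intros coning coord inset ballI)
    fix p assume "p \<in> ?A"
    then show "1 - (\<Sum>F\<in>facets. card F * inset F (fst p) (snd p)) \<noteq> 0"
      using deflate_den[of "snd p" "fst p"] by auto
  qed auto
  then have "continuous_on ?A deflate"
    by (rule continuous_on_coordinatewise_then_product)
  moreover have "deflate ` ?A \<subseteq> realization"
    using deflate_in_realization by auto
  ultimately show ?thesis
    by (simp add: image_subset_iff_funcset )
qed

text \<open>The map \<open>f\<close> is injective on the open facets and crushes everything else to
  the base point, so a homotopy respects its fibres if it keeps the crushed part inside
  itself.\<close>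

theorem realization_homotopy_equivalent_bouquet:
  assumes \<phi>: "bij_betw \<phi> I facets"
  shows "top_of_set realization homotopy_equivalent_space sphere_bouquet I (\<lambda>i. card (\<phi> i) - 1)"
proof -
  define f where "f x = (if vsupp x \<in> facets then Some (inv_into I \<phi> (vsupp x), collapse (vsupp x) x) else None)" for x
  have fin: "finite I" using bij_betw_finite[OF \<phi>] finite_facets by blast
  have \<phi>_in: "\<phi> i \<in> facets" if "i \<in> I" for i using \<phi> that by (auto simp: bij_betw_def)
  have inv: "inv_into I \<phi> (\<phi> i) = i" if "i \<in> I" for i using \<phi> that by (simp add: bij_betw_def)
  have off: "collapse (\<phi> i) x \<noteq> sphere_basepoint \<longleftrightarrow> vsupp x = \<phi> i" if "i \<in> I" "x \<in> realization" for i x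
    using collapse_eq_base_iff[OF facet_face[OF \<phi>_in[OF that(1)]]] depth_eq_0_iff[OF \<phi>_in[OF that(1)] that(2)] by blast
  let ?e = "\<lambda>w. if w = a then 1 else 0 :: real"
  have e: "?e \<in> realization" by (rule vertex_realization[OF apex])
  have "vsupp ?e = {a}" by auto
  then have e_star: "vsupp ?e \<notin> facets" using apex_notin_facet by auto
  have quot: "quotient_map (top_of_set realization) (sphere_bouquet I (\<lambda>i. card (\<phi> i) - 1)) f"
    unfolding sphere_bouquet_def
  proof (rule quotient_map_onto_wedge[where \<Phi> = "\<lambda>i. collapse (\<phi> i)" and ?x0.0 = ?e])
    show "compact_space (top_of_set realization)"
      using compact_realization by (simp add: compact_space_subtopology compactin_euclidean_iff)
    show "Hausdorff_space (nsphere (card (\<phi> i) - 1))" for i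
      unfolding nsphere by (intro Hausdorff_space_subtopology) (simp add: Hausdorff_space_product_topology)
    show "sphere_basepoint \<in> topspace (nsphere (card (\<phi> i) - 1))" for i by (rule sphere_basepoint)
    show cont: "continuous_map (top_of_set realization) (nsphere (card (\<phi> i) - 1)) (collapse (\<phi> i))" if "i \<in> I" for i
      by (rule continuous_collapse[OF \<phi>_in[OF that]])
    show "collapse (\<phi> i) ` topspace (top_of_set realization) = topspace (nsphere (card (\<phi> i) - 1))" if "i \<in> I" for i
      using continuous_map_image_subset_topspace[OF cont[OF that]] collapse_surj[OF \<phi>_in[OF that]] by fastforce
    show "i = j" if "i \<in> I" "j \<in> I" "x \<in> topspace (top_of_set realization)"
      "collapse (\<phi> i) x \<noteq> sphere_basepoint" "collapse (\<phi> j) x \<noteq> sphere_basepoint" for i j x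
    proof -
      have "\<phi> i = \<phi> j" using off that by force
      then show ?thesis using inv that by metis
    qed
    show "?e \<in> topspace (top_of_set realization)" using e by simp
    show "collapse (\<phi> i) ?e = sphere_basepoint" if "i \<in> I" for i
      using off[OF that e] e_star \<phi>_in[OF that] by metis
    show "f x = Some (i, collapse (\<phi> i) x)"
      if "i \<in> I" "x \<in> topspace (top_of_set realization)" "collapse (\<phi> i) x \<noteq> sphere_basepoint" for i x
    proof -
      have "vsupp x = \<phi> i" using that off by simp
      then show ?thesis using \<phi>_in[OF that(1)] inv[OF that(1)] by (simp add: f_def)
    qed
    show "f x = None"
      if "x \<in> topspace (top_of_set realization)" "\<And>i. i \<in> I \<Longrightarrow> collapse (\<phi> i) x = sphere_basepoint" for x
    proof -
      have "vsupp x \<notin> facets"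
      proof
        assume "vsupp x \<in> facets"
        then obtain i where "i \<in> I" "vsupp x = \<phi> i" using \<phi> by (auto simp: bij_betw_def)
        then show False using that off by force
      qed
      then show ?thesis by (simp add: f_def)
    qed
  qed (rule fin)
  have f_eq: "x = y \<or> vsupp x \<notin> facets \<and> vsupp y \<notin> facets"
    if xy: "x \<in> realization" "y \<in> realization" "f x = f y" for x y
  proof (cases "vsupp x \<in> facets \<and> vsupp y \<in> facets")
    case True
    then obtain i j where ij: "i \<in> I" "vsupp x = \<phi> i" "j \<in> I" "vsupp y = \<phi> j"
      using \<phi> unfolding bij_betw_def by (metis imageE)
    then have "i = j" "collapse (\<phi> i) x = collapse (\<phi> j) y"
      using xy(3) True inv by (auto simp: f_def)
    moreover have "0 < depth (\<phi> i) x" "0 < depth (\<phi> j) y"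
      using ij depth_pos_iff \<phi>_in xy by blast+
    ultimately show ?thesis using collapse_inj[OF \<phi>_in[OF ij(1)]] xy by blast
  qed (use xy(3) in \<open>auto simp: f_def split: if_splits\<close>)
  \<comment> \<open>Moving towards the apex adds at most \<open>a\<close> to the support. A facet
    omits \<open>a\<close>, so as a new support it would lie in the old one and equal it by
    maximality.\<close>
  have star: "vsupp (deflate (t, x)) \<notin> facets"
    if x: "x \<in> realization" "vsupp x \<notin> facets" and t: "t \<in> {0..1}" for t x
  proof
    assume F: "vsupp (deflate (t, x)) \<in> facets"
    have "vsupp (deflate (t, x)) \<subseteq> insert a (vsupp x)"
      using deflate_star(1)[OF x] t by auto
    then have "vsupp (deflate (t, x)) \<subseteq> vsupp x"
      using apex_notin_facet[OF F] by blast
    then have "vsupp x = vsupp (deflate (t, x))"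
      using facet_maximal[OF F realizationD(2)[OF x(1)]] by blast
    then show False using F x(2) by simp
  qed
  show ?thesis
  proof (rule homotopy_equivalent_space_quotient[OF quot continuous_deflate])
    show "deflate (0, x) = x" if "x \<in> topspace (top_of_set realization)" for x
      using that deflate_0 by simp
    fix x y assume xy: "x \<in> topspace (top_of_set realization)" "y \<in> topspace (top_of_set realization)" "f x = f y"
    then have *: "x = y \<or> vsupp x \<notin> facets \<and> vsupp y \<notin> facets" using f_eq by simp
    show "f (deflate (t, x)) = f (deflate (t, y))" if "t \<in> {0..1}" for t
      using * star[OF _ _ that] xy by (auto simp: f_def)
    show "deflate (1, x) = deflate (1, y)"
      using * xy deflate_star(1)[of _ 1] by auto
  qed
qed

end

section \<open>Connectedness\<close>

text \<open>The library's \<^const>\<open>subpath\<close> is only available in normed vector spaces, hence the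
  compositions with \<^const>\<open>linepath\<close>.\<close>

lemma homotopic_paths_join_linepaths:
  fixes p :: "real \<Rightarrow> 'b::topological_space"
  assumes p: "path p" "path_image p \<subseteq> S" and uvw: "u \<in> {0..1}" "v \<in> {0..1}" "w \<in> {0..1}"
  shows "homotopic_paths S ((p \<circ> linepath u v) +++ (p \<circ> linepath v w)) (p \<circ> linepath u w)"
proof -
  have seg: "path_image (linepath x y) \<subseteq> {0..1}" if "x \<in> {0..1}" "y \<in> {0..1}" for x y :: real
    unfolding path_image_linepath using that by (intro closed_segment_subset) auto
  have "path_image (linepath u v +++ linepath v w) \<subseteq> {0..1}" "path_image (linepath u w) \<subseteq> {0..1}"
    using seg uvw by (simp_all add: subset_path_image_join)
  \<comment> \<open>The parameter paths are homotopic already in the convex interval;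
    \<open>p\<close> carries this homotopy into \<open>S\<close>.\<close>
  then have "homotopic_paths {0..1} (linepath u v +++ linepath v w) (linepath u w)"
    using convex_imp_simply_connected[of "{0..1::real}"]
    unfolding simply_connected_eq_homotopic_paths by simp
  then have "homotopic_paths S (p \<circ> (linepath u v +++ linepath v w)) (p \<circ> linepath u w)"
    by (rule homotopic_paths_continuous_image) (use p in \<open>auto simp: path_def path_image_def\<close>)
  then show ?thesis by (simp add: path_compose_join)
qed

definition fun_segment :: "('a \<Rightarrow> real) \<Rightarrow> ('a \<Rightarrow> real) \<Rightarrow> real \<Rightarrow> 'a \<Rightarrow> real" where
  "fun_segment x y t v = (1 - t) * x v + t * y v"

lemma pathstart_fun_segment [simp]: "pathstart (fun_segment x y) = x"
  and pathfinish_fun_segment [simp]: "pathfinish (fun_segment x y) = y"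
  by (simp_all add: fun_segment_def pathstart_def pathfinish_def fun_eq_iff)

lemma fun_segment_simps [simp]:
  "fun_segment x y 0 = x" "fun_segment x y 1 = y" "fun_segment x x t = x"
  by (simp_all add: fun_segment_def fun_eq_iff algebra_simps)

lemma path_imp_continuous_coordinate:
  fixes p :: "real \<Rightarrow> 'a \<Rightarrow> real"
  shows "path p \<Longrightarrow> continuous_on {0..1} (\<lambda>t. p t v)"
  unfolding path_def by (rule continuous_on_product_then_coordinatewise)

lemma reversepath_fun_segment: "reversepath (fun_segment x y) = fun_segment y x"
  by (simp add: reversepath_def fun_segment_def fun_eq_iff)

lemma path_fun_segment [simp]: "path (fun_segment x y)"
  unfolding path_def fun_segment_def
  by (intro continuous_on_coordinatewise_then_product continuous_intros)

section \<open>Paths in closed simplices and in stars\<close>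

context cone_with_facets
begin

definition cell :: "'a set \<Rightarrow> ('a \<Rightarrow> real) set" where
  "cell S = {x \<in> realization. vsupp x \<subseteq> S}"

lemma cell_subset: "cell S \<subseteq> realization"
  by (auto simp: cell_def)

lemma in_cell_vsupp: "x \<in> realization \<Longrightarrow> x \<in> cell (vsupp x)"
  by (simp add: cell_def)

lemma fun_segment_in_cell:
  assumes S: "S \<in> K" and x: "x \<in> cell S" and y: "y \<in> cell S" and t: "0 \<le> t" "t \<le> 1"
  shows "fun_segment x y t \<in> cell S"
proof -
  have xy: "x \<in> realization" "y \<in> realization" "vsupp x \<subseteq> S" "vsupp y \<subseteq> S"
    using x y by (auto simp: cell_def)
  have sums: "sum x S = 1" "sum y S = 1"
    using realizationD(3) xy finite_face[OF S] by blast+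
  have supp: "vsupp (fun_segment x y t) \<subseteq> S"
  proof
    fix v assume "v \<in> vsupp (fun_segment x y t)"
    then have "x v \<noteq> 0 \<or> y v \<noteq> 0" by (auto simp: fun_segment_def)
    then show "v \<in> S" using xy(3,4) by blast
  qed
  have "fun_segment x y t \<in> realization"
  proof (rule realizationI[OF _ supp S])
    show "0 \<le> fun_segment x y t v" for v
      using t realizationD(1)[OF xy(1)] realizationD(1)[OF xy(2)] by (simp add: fun_segment_def)
    show "sum (fun_segment x y t) S = 1"
      by (simp add: fun_segment_def sum.distrib sum_distrib_left[symmetric] sums)
  qed
  then show ?thesis using supp by (simp add: cell_def)
qed

lemma path_image_fun_segment:
  assumes "S \<in> K" "x \<in> cell S" "y \<in> cell S"
  shows "path_image (fun_segment x y) \<subseteq> cell S"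
  using fun_segment_in_cell[OF assms] by (auto simp: path_image_def)

lemma homotopic_paths_in_cell:
  assumes S: "S \<in> K" and p: "path p" "path_image p \<subseteq> cell S" and q: "path q" "path_image q \<subseteq> cell S"
    and ends: "pathstart p = pathstart q" "pathfinish p = pathfinish q"
  shows "homotopic_paths realization p q"
proof -
  define h where "h z = fun_segment (p (snd z)) (q (snd z)) (fst z)" for z :: "real \<times> real"
  have "continuous_on ({0..1} \<times> {0..1}) (\<lambda>z. r (snd z) v)" if "path r" for r :: "real \<Rightarrow> 'a \<Rightarrow> real" and v
    by (rule continuous_on_compose2[OF path_imp_continuous_coordinate[OF that] continuous_on_snd[OF continuous_on_id]])
       (simp add: image_subset_iff)
  then have "continuous_on ({0..1} \<times> {0..1}) h"
    unfolding h_def fun_segment_def using p(1) q(1)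
    by (intro continuous_on_coordinatewise_then_product continuous_intros) auto
  moreover have "h z \<in> realization" if "z \<in> {0..1} \<times> {0..1}" for z
  proof -
    have "0 \<le> fst z" "fst z \<le> 1" "snd z \<in> {0..1}" using that by auto
    moreover from this have "p (snd z) \<in> cell S" "q (snd z) \<in> cell S"
      using p(2) q(2) by (auto simp: path_image_def)
    ultimately show ?thesis
      unfolding h_def using fun_segment_in_cell[OF S] cell_subset by blast
  qed
  ultimately show ?thesis
    unfolding homotopic_paths using ends
    by (intro exI[of _ h])
       (simp add: h_def pathstart_def pathfinish_def Pi_iff)
qed

text \<open>Segments from the start \<open>c\<close> to points of \<open>p\<close> stay in the
  realization, but segments between other points need not, so \<open>p\<close> cannot be
  straightened by a linear homotopy. Both stages therefore move only along segments issuing from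
  \<open>c\<close>, through the path that at time \<open>t\<close> is at fraction \<open>t\<close>
  of the way from \<open>c\<close> to \<open>p t\<close>.\<close>

lemma homotopic_paths_in_star:
  assumes p: "path p" "path_image p \<subseteq> {x \<in> realization. vsupp (pathstart p) \<subseteq> vsupp x}"
  shows "homotopic_paths realization p (fun_segment (pathstart p) (pathfinish p))"
proof -
  define c where "c = p 0"
  have c: "pathstart p = c" "c \<in> realization"
    using p(2) by (simp_all add: c_def pathstart_def path_image_def image_subset_iff)
  have p_star: "p t \<in> realization" "c \<in> cell (vsupp (p t))" if "t \<in> {0..1}" for t
    using p(2) c that by (simp_all add: path_image_def image_subset_iff cell_def)
  have in_X: "fun_segment c (p t) u \<in> realization" if "t \<in> {0..1}" "0 \<le> u" "u \<le> 1" for t u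
    using fun_segment_in_cell[OF realizationD(2)[OF p_star(1)[OF that(1)]] p_star(2)[OF that(1)]
        in_cell_vsupp[OF p_star(1)[OF that(1)]] that(2,3)] cell_subset by blast
  have homotopy: "homotopic_paths realization (\<lambda>t. fun_segment c (p (w (0, t))) (u (0, t)))
      (\<lambda>t. fun_segment c (p (w (1, t))) (u (1, t)))"
    if cont: "continuous_on ({0..1} \<times> {0..1}) u" "continuous_on ({0..1} \<times> {0..1}) w"
      and range: "\<And>z. z \<in> {0..1} \<times> {0..1} \<Longrightarrow> u z \<in> {0..1} \<and> w z \<in> {0..1}"
      and start: "\<And>s. s \<in> {0..1} \<Longrightarrow> u (s, 0) = 0 \<or> w (s, 0) = 0"
      and finish: "\<And>s. s \<in> {0..1} \<Longrightarrow> u (s, 1) = 1 \<and> w (s, 1) = 1"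
    for u w :: "real \<times> real \<Rightarrow> real"
  proof -
    define h where "h z = fun_segment c (p (w z)) (u z)" for z
    have "continuous_on ({0..1} \<times> {0..1}) (\<lambda>z. p (w z) v)" for v
      by (rule continuous_on_compose2[OF path_imp_continuous_coordinate[OF p(1)] cont(2)])
         (use range in \<open>simp add: image_subset_iff\<close>)
    then have "continuous_on ({0..1} \<times> {0..1}) h"
      unfolding h_def fun_segment_def
      by (intro continuous_on_coordinatewise_then_product continuous_intros cont)
    moreover have "h \<in> {0..1} \<times> {0..1} \<rightarrow> realization"
      unfolding h_def using range in_X by (simp add: Pi_iff)
    moreover have "h (s, 0) = c" if "s \<in> {0..1}" for s
      using start[OF that] by (auto simp: h_def c_def)
    moreover have "h (s, 1) = p 1" if "s \<in> {0..1}" for s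
      using finish[OF that] by (simp add: h_def)
    ultimately show ?thesis
      unfolding homotopic_paths
      by (intro exI[of _ h]) (auto simp: pathstart_def pathfinish_def h_def[symmetric])
  qed
  have prod01: "0 \<le> s * (1 - t)" "s * (1 - t) \<le> 1 - t" if "s \<in> {0..1}" "t \<in> {0..1}" for s t :: real
    using that mult_left_le_one_le[of "1 - t" s] by auto
  have snd: "continuous_on ({0..1} \<times> {0..1}) (snd :: real \<times> real \<Rightarrow> real)"
    by (intro continuous_intros)
  have "homotopic_paths realization (\<lambda>t. fun_segment c (p t) 1) (\<lambda>t. fun_segment c (p t) t)"
  proof -
    \<comment> \<open>At homotopy time \<open>s\<close> the fraction \<open>1 - s * (1 - t)\<close>
      passes from 1 to \<open>t\<close>, and it stays 1 at the end \<open>t = 1\<close>.\<close>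
    let ?u = "\<lambda>z :: real \<times> real. 1 - fst z * (1 - snd z)"
    have range: "?u z \<in> {0..1} \<and> snd z \<in> {0..1}" if "z \<in> {0..1} \<times> {0..1}" for z
      using prod01[of "fst z" "snd z"] that by auto
    have cont: "continuous_on ({0..1} \<times> {0..1}) ?u"
      by (intro continuous_intros)
    show ?thesis using homotopy[OF cont snd range] by simp
  qed
  also have "homotopic_paths realization (\<lambda>t. fun_segment c (p t) t) (\<lambda>t. fun_segment c (p 1) t)"
  proof -
    \<comment> \<open>Here the target moves along \<open>p\<close>: the parameter
      \<open>t + s * (1 - t)\<close> passes from \<open>t\<close> to 1.\<close>
    let ?w = "\<lambda>z :: real \<times> real. snd z + fst z * (1 - snd z)"
    have range: "snd z \<in> {0..1} \<and> ?w z \<in> {0..1}" if "z \<in> {0..1} \<times> {0..1}" for z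
      using prod01[of "fst z" "snd z"] that by auto
    have cont: "continuous_on ({0..1} \<times> {0..1}) ?w"
      by (intro continuous_intros)
    show ?thesis using homotopy[OF snd cont range] by simp
  qed
  finally show ?thesis
    unfolding c(1) by (simp add: pathfinish_def)
qed

section \<open>Vertices and path components\<close>

abbreviation vertex :: "'a \<Rightarrow> 'a \<Rightarrow> real" where
  "vertex v \<equiv> \<lambda>w. if w = v then 1 else 0"

lemma vertex_in_cell: "S \<in> K \<Longrightarrow> v \<in> S \<Longrightarrow> vertex v \<in> cell S"
  using vertex_realization[of v] subface[of S "{v}"] by (auto simp: cell_def)

lemma face_vertex: "x \<in> realization \<Longrightarrow> \<exists>v. v \<in> vsupp x"
  using realizationD(2) nonempty_face by blast

lemma path_connected_realization:
  assumes "\<And>F. F \<in> facets \<Longrightarrow> 2 \<le> card F"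
  shows "path_connected realization"
proof -
  have "path_component realization (vertex a) x" if x: "x \<in> realization" for x
  proof -
    obtain v where v: "v \<in> vsupp x" using face_vertex[OF x] by blast
    have S: "vsupp x \<in> K" using realizationD(2)[OF x] .
    have "{v} \<in> K" using S v subface[of "vsupp x" "{v}"] by blast
    moreover have "{v} \<notin> facets" using assms[of "{v}"] by auto
    ultimately have av: "{a, v} \<in> K" by (rule cone_face)
    have "path_component realization (vertex a) (vertex v)"
      unfolding path_component_def
      using path_image_fun_segment[OF av vertex_in_cell[OF av] vertex_in_cell[OF av], of a v] cell_subset
      by (intro exI[of _ "fun_segment (vertex a) (vertex v)"]) auto
    moreover have "path_component realization (vertex v) x"
      unfolding path_component_def
      using path_image_fun_segment[OF S vertex_in_cell[OF S v] in_cell_vsupp[OF x]] cell_subset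
      by (intro exI[of _ "fun_segment (vertex v) x"]) auto
    ultimately show ?thesis by (rule path_component_trans)
  qed
  then show ?thesis
    unfolding path_connected_component by (meson path_component_sym path_component_trans)
qed

text \<open>By maximality of \<open>{s}\<close>, a point with positive coordinate at
  \<open>s\<close> is the vertex \<open>s\<close> itself, so this coordinate takes the values 0 and
  1 and nothing between.\<close>

lemma not_connected_realization:
  assumes F: "{s} \<in> facets"
  shows "\<not> connected realization"
proof
  assume "connected realization"
  then have "connected ((\<lambda>x. x s) ` realization)"
    by (rule connected_continuous_image[OF continuous_on_coordinate])
  moreover have "0 \<in> (\<lambda>x. x s) ` realization"
    using vertex_realization[OF apex] apex_notin_facet[OF F] by (intro image_eqI[of _ _ "vertex a"]) auto
  moreover have "1 \<in> (\<lambda>x. x s) ` realization"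
    using vertex_realization[OF facet_face[OF F]] by (intro image_eqI[of _ _ "vertex s"]) auto
  ultimately have "1 / 2 \<in> (\<lambda>x. x s) ` realization"
    by (rule connectedD_interval) auto
  then obtain x where x: "x \<in> realization" "x s = 1 / 2" by auto
  then have "vsupp x = {s}"
    by (intro facet_maximal[OF F realizationD(2)[OF x(1)]]) auto
  then have "x s = 1"
    using realizationD(3)[OF x(1), of "{s}"] by simp
  then show False using x(2) by simp
qed

section \<open>Loops and the fundamental group\<close>

lemma homotopic_paths_fun_segment_join:
  assumes "S \<in> K" "x \<in> cell S" "y \<in> cell S" "z \<in> cell S"
  shows "homotopic_paths realization (fun_segment x y +++ fun_segment y z) (fun_segment x z)"
  using assms by (intro homotopic_paths_in_cell[of S] path_join_imp subset_path_image_join path_image_fun_segment) auto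

text \<open>Instead of subdividing a loop, an invariant is carried along it: up to time
  \<open>t\<close> the loop is homotopic to a reference path \<open>g v\<close> followed by the
  segment from \<open>v\<close> to \<open>p t\<close>, for every vertex \<open>v\<close> of the
  support. Independence of \<open>v\<close> is where the triangles are used; connectedness of the
  interval then takes the invariant from 0 to 1.\<close>

lemma simply_conn_realization:
  assumes card_facets: "\<And>F. F \<in> facets \<Longrightarrow> 3 \<le> card F"
  shows "simply_conn realization"
  unfolding simply_conn_def
proof (intro conjI ballI)
  show "path_connected realization"
  proof (rule path_connected_realization)
    show "2 \<le> card F" if "F \<in> facets" for F using card_facets[OF that] by simp
  qed
  fix b assume b: "b \<in> realization"
  have small: "F \<notin> facets" if "card F \<le> 2" for F using card_facets[of F] that by linarith
  have edge: "{a, v} \<in> K" if "v \<in> S" "S \<in> K" for v S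
  proof -
    have "{v} \<in> K" using that subface[of S "{v}"] by simp
    then show ?thesis by (rule cone_face) (simp add: small)
  qed
  have triangle: "{a, v, w} \<in> K" if "v \<in> S" "w \<in> S" "S \<in> K" for v w S
  proof -
    have "{v, w} \<in> K" using that subface[of S "{v, w}"] by simp
    moreover have "card {v, w} \<le> 2" by (simp add: card_insert_if)
    ultimately show ?thesis using cone_face small by blast
  qed
  have sub: "path_image (fun_segment x y) \<subseteq> realization" if "S \<in> K" "x \<in> cell S" "y \<in> cell S" for S x y
    using path_image_fun_segment[OF that] cell_subset by blast
  obtain u where u: "u \<in> vsupp b" using face_vertex[OF b] by blast
  have bK: "vsupp b \<in> K" using realizationD(2)[OF b] .
  \<comment> \<open>The base point need not be a vertex, so the reference paths first go to a vertex
    \<open>u\<close> of its support and from there to the apex.\<close>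
  define \<omega> where "\<omega> = fun_segment b (vertex u) +++ fun_segment (vertex u) (vertex a)"
  define g where "g v = \<omega> +++ fun_segment (vertex a) (vertex v)" for v
  have s1: "path_image (fun_segment b (vertex u)) \<subseteq> realization"
    by (rule sub[OF bK in_cell_vsupp[OF b] vertex_in_cell[OF bK u]])
  have uaK: "{a, u} \<in> K" by (rule edge[OF u bK])
  have s2: "path_image (fun_segment (vertex u) (vertex a)) \<subseteq> realization"
    by (rule sub[OF uaK]) (use uaK in \<open>auto intro: vertex_in_cell\<close>)
  have \<omega>: "path \<omega>" "path_image \<omega> \<subseteq> realization" "pathstart \<omega> = b" "pathfinish \<omega> = vertex a"
    unfolding \<omega>_def using subset_path_image_join[OF s1 s2] by (simp_all add: path_join_imp)
  have s3: "path_image (fun_segment (vertex a) (vertex v)) \<subseteq> realization" if "v \<in> S" "S \<in> K" for v S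
    by (rule sub[OF edge[OF that]]) (use edge[OF that] in \<open>auto intro: vertex_in_cell\<close>)
  have g: "path (g v)" "path_image (g v) \<subseteq> realization" "pathstart (g v) = b" "pathfinish (g v) = vertex v"
    if "v \<in> S" "S \<in> K" for v S
    unfolding g_def using \<omega> subset_path_image_join[OF \<omega>(2) s3[OF that]] by (simp_all add: path_join_imp)
  have gx: "path_image (fun_segment (vertex v) x) \<subseteq> realization" if "x \<in> realization" "v \<in> vsupp x" for v x
    by (rule sub[OF realizationD(2)[OF that(1)]])
       (use that realizationD(2)[OF that(1)] in \<open>auto intro: vertex_in_cell in_cell_vsupp\<close>)
  have extend: "homotopic_paths realization ((g v +++ fun_segment (vertex v) x) +++ fun_segment x y)
      (g v +++ fun_segment (vertex v) y)"
    if S: "S \<in> K" and v: "v \<in> S" and x: "x \<in> cell S" and y: "y \<in> cell S" for v x y S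
  proof -
    have vx: "path_image (fun_segment (vertex v) x) \<subseteq> realization" "path_image (fun_segment x y) \<subseteq> realization"
      using sub[OF S vertex_in_cell[OF S v] x] sub[OF S x y] by blast+
    have "homotopic_paths realization ((g v +++ fun_segment (vertex v) x) +++ fun_segment x y)
        (g v +++ (fun_segment (vertex v) x +++ fun_segment x y))"
      by (rule homotopic_paths_sym, rule homotopic_paths_assoc) (use g[OF v S] vx in auto)
    also have "homotopic_paths realization \<dots> (g v +++ fun_segment (vertex v) y)"
      using g[OF v S]
      by (intro homotopic_paths_join homotopic_paths_fun_segment_join[OF S vertex_in_cell[OF S v] x y]) auto
    finally show ?thesis .
  qed
  have g_edge: "homotopic_paths realization (g v +++ fun_segment (vertex v) (vertex w)) (g w)"
    if S: "S \<in> K" "v \<in> S" "w \<in> S" for v w S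
  proof -
    \<comment> \<open>Here facets with two elements would do harm: the triangle over the edge from
      \<open>v\<close> to \<open>w\<close> has to be filled.\<close>
    have T: "{a, v, w} \<in> K" by (rule triangle[OF S(2,3,1)])
    have in_T: "vertex a \<in> cell {a, v, w}" "vertex v \<in> cell {a, v, w}" "vertex w \<in> cell {a, v, w}"
      by (rule vertex_in_cell[OF T], simp)+
    have "homotopic_paths realization (g v +++ fun_segment (vertex v) (vertex w))
        (\<omega> +++ (fun_segment (vertex a) (vertex v) +++ fun_segment (vertex v) (vertex w)))"
      unfolding g_def
      by (rule homotopic_paths_sym, rule homotopic_paths_assoc) (use \<omega> sub[OF T] in_T in auto)
    also have "homotopic_paths realization \<dots> (g w)"
      unfolding g_def using \<omega>
      by (intro homotopic_paths_join homotopic_paths_fun_segment_join[OF T in_T]) auto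
    finally show ?thesis .
  qed
  have switch: "homotopic_paths realization (g v +++ fun_segment (vertex v) x) (g w +++ fun_segment (vertex w) x)"
    if x: "x \<in> realization" and v: "v \<in> vsupp x" and w: "w \<in> vsupp x" for v w x
  proof -
    have S: "vsupp x \<in> K" using realizationD(2)[OF x] .
    have "homotopic_paths realization (g v +++ fun_segment (vertex v) x)
        ((g v +++ fun_segment (vertex v) (vertex w)) +++ fun_segment (vertex w) x)"
      by (rule homotopic_paths_sym, rule extend[OF S v vertex_in_cell[OF S w] in_cell_vsupp[OF x]])
    also have "homotopic_paths realization \<dots> (g w +++ fun_segment (vertex w) x)"
      using gx[OF x w] by (intro homotopic_paths_join g_edge[OF S v w]) (auto simp: g_def)
    finally show ?thesis .
  qed
  have const: "homotopic_paths realization (g u +++ fun_segment (vertex u) b) (\<lambda>t. b)"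
  proof -
    have in_T: "vertex a \<in> cell {a, u}" "vertex u \<in> cell {a, u}"
      by (rule vertex_in_cell[OF uaK], simp)+
    have ub: "vertex u \<in> cell (vsupp b)" by (rule vertex_in_cell[OF bK u])
    have "homotopic_paths realization (g u) (fun_segment b (vertex u) +++
        (fun_segment (vertex u) (vertex a) +++ fun_segment (vertex a) (vertex u)))"
      unfolding g_def \<omega>_def
      by (rule homotopic_paths_sym, rule homotopic_paths_assoc) (use s1 s2 s3[OF u bK] in auto)
    also have "homotopic_paths realization \<dots> (fun_segment b (vertex u) +++ fun_segment (vertex u) (vertex u))"
      using s1 by (intro homotopic_paths_join homotopic_paths_fun_segment_join[OF uaK in_T(2) in_T(1) in_T(2)]) auto
    also have "homotopic_paths realization \<dots> (fun_segment b (vertex u))"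
      by (rule homotopic_paths_fun_segment_join[OF bK in_cell_vsupp[OF b] ub ub])
    finally have "homotopic_paths realization (g u +++ fun_segment (vertex u) b)
        (fun_segment b (vertex u) +++ fun_segment (vertex u) b)"
      using gx[OF b u] g(4)[OF u bK] by (intro homotopic_paths_join) auto
    also have "homotopic_paths realization \<dots> (fun_segment b b)"
      by (rule homotopic_paths_fun_segment_join[OF bK in_cell_vsupp[OF b] ub in_cell_vsupp[OF b]])
    also have "fun_segment b b = (\<lambda>t. b)" by (rule ext) simp
    finally show ?thesis .
  qed
  have null: "homotopic_paths realization p (\<lambda>t. b)" if p: "p \<in> based_loops realization b" for p
  proof -
    have path: "path p" "path_image p \<subseteq> realization" and p0: "p 0 = b" and p1: "p 1 = b"
      using p by (auto simp: based_loops_def pathstart_def pathfinish_def)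
    have pX: "p t \<in> realization" if "t \<in> {0..1}" for t
      using path(2) that by (auto simp: path_image_def)
    \<comment> \<open>\<^term>\<open>P\<close> is locally constant: for \<^term>\<open>t\<close> near \<^term>\<open>t0\<close> the support of \<^term>\<open>p t\<close> contains that of \<^term>\<open>p t0\<close>,
      so \<^term>\<open>p\<close> stays in a set that is star-shaped around \<^term>\<open>p t0\<close>.\<close>
    define P where "P t \<longleftrightarrow> (\<forall>v\<in>vsupp (p t). homotopic_paths realization (p \<circ> linepath 0 t)
        (g v +++ fun_segment (vertex v) (p t)))" for t
    \<comment> \<open>By \<open>switch\<close>, one vertex of the support suffices to establish the
      invariant.\<close>
    have P_I: "P t" if "t \<in> {0..1}" "w \<in> vsupp (p t)"
      "homotopic_paths realization (p \<circ> linepath 0 t) (g w +++ fun_segment (vertex w) (p t))" for t w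
      unfolding P_def using homotopic_paths_trans[OF that(3) switch[OF pX[OF that(1)] that(2)]] by blast
    have lin0: "p \<circ> linepath 0 0 = (\<lambda>t. b)" by (simp add: o_def linepath_def p0)
    have "P 0"
      using const u by (intro P_I[of 0 u]) (simp_all add: p0 lin0 homotopic_paths_sym)
    have "P 1"
    proof (rule connected_induction_simple[of "{0..1::real}" 0 1 P])
      fix t0 :: real assume t0: "t0 \<in> {0..1}"
      define S where "S = vsupp (p t0)"
      have S: "S \<in> K" "finite S" "S \<noteq> {}"
        using realizationD(2)[OF pX[OF t0]] finite_face nonempty_face by (auto simp: S_def)
      define U where "U = (\<Inter>v\<in>S. {t \<in> {0..1}. p t v \<noteq> 0})"
      have "openin (top_of_set {0..1}) {t \<in> {0..1}. p t v \<noteq> 0}" for v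
        using continuous_openin_preimage_gen[OF path_imp_continuous_coordinate[OF path(1), of v]
            open_Compl[OF closed_singleton[of 0]]]
        by (simp add: vimage_def Int_def)
      then have "openin (top_of_set {0..1}) U"
        unfolding U_def using S by (intro openin_INT2) auto
      moreover have "t0 \<in> U" using t0 by (auto simp: U_def S_def)
      ultimately obtain e where e: "e > 0" "ball t0 e \<inter> {0..1} \<subseteq> U"
        unfolding openin_contains_ball by blast
      let ?T = "{0..1} \<inter> ball t0 e"
      have supp: "S \<subseteq> vsupp (p t)" if "t \<in> ?T" for t
        using e(2) that unfolding U_def by blast
      have local: "homotopic_paths realization (p \<circ> linepath t0 t) (fun_segment (p t0) (p t))" if t: "t \<in> ?T" for t
      proof -
        have cs: "closed_segment t0 t \<subseteq> ?T"
          using t t0 e(1) by (intro closed_segment_subset convex_Int) auto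
        have "path (p \<circ> linepath t0 t)"
          using cs path(1) unfolding path_def
          by (intro continuous_on_compose continuous_on_linepath)
             (auto intro: continuous_on_subset simp: linepath_image_01)
        moreover have "path_image (p \<circ> linepath t0 t) \<subseteq> {x \<in> realization. S \<subseteq> vsupp x}"
          unfolding path_image_compose path_image_linepath using cs supp pX by blast
        moreover have "pathstart (p \<circ> linepath t0 t) = p t0" "pathfinish (p \<circ> linepath t0 t) = p t"
          by (simp_all add: pathstart_compose pathfinish_compose)
        ultimately show ?thesis
          using homotopic_paths_in_star[of "p \<circ> linepath t0 t"] by (simp add: S_def)
      qed
      have local': "homotopic_paths realization (p \<circ> linepath t t0) (fun_segment (p t) (p t0))" if t: "t \<in> ?T" for t
      proof -
        have "reversepath (p \<circ> linepath t0 t) = p \<circ> linepath t t0"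
          by (simp add: reversepath_def linepath_def fun_eq_iff algebra_simps)
        then show ?thesis
          using homotopic_paths_reversepath_D[OF local[OF t]] by (simp add: reversepath_fun_segment)
      qed
      \<comment> \<open>Serves both directions in time: a common vertex \<open>w\<close> and a face
        \<open>S'\<close> carrying both points suffice. Near \<open>t0\<close> the support of
        \<open>p t\<close> is such a face, as it contains that of \<open>p t0\<close>.\<close>
      have step: "P y" if h: "x \<in> {0..1}" "y \<in> {0..1}" "P x" "w \<in> vsupp (p x)" "w \<in> vsupp (p y)"
        "S' \<in> K" "vsupp (p x) \<subseteq> S'" "vsupp (p y) \<subseteq> S'"
        "homotopic_paths realization (p \<circ> linepath x y) (fun_segment (p x) (p y))" for x y w S'
      proof (rule P_I[OF h(2,5)])
        have "homotopic_paths realization (p \<circ> linepath 0 y) ((p \<circ> linepath 0 x) +++ (p \<circ> linepath x y))"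
          by (rule homotopic_paths_sym, rule homotopic_paths_join_linepaths[OF path]) (use h in auto)
        also have "homotopic_paths realization \<dots> ((g w +++ fun_segment (vertex w) (p x)) +++ fun_segment (p x) (p y))"
          using h(3,4,9) unfolding P_def
          by (intro homotopic_paths_join) (auto simp: pathstart_compose pathfinish_compose)
        also have "homotopic_paths realization \<dots> (g w +++ fun_segment (vertex w) (p y))"
          using h pX by (intro extend[of S']) (auto simp: cell_def)
        finally show "homotopic_paths realization (p \<circ> linepath 0 y) (g w +++ fun_segment (vertex w) (p y))" .
      qed
      obtain w where w: "w \<in> S" using S(3) by blast
      have "P t0 \<longleftrightarrow> P t" if t: "t \<in> ?T" for t
      proof
        have wt: "w \<in> vsupp (p t0)" "w \<in> vsupp (p t)" "vsupp (p t) \<in> K" "vsupp (p t0) \<subseteq> vsupp (p t)"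
          using w supp[OF t] realizationD(2)[OF pX] t by (auto simp: S_def)
        show "P t" if "P t0"
          by (rule step[OF t0 _ that wt(1,2,3,4) order_refl local[OF t]]) (use t in simp)
        show "P t0" if "P t"
          by (rule step[OF _ t0 that wt(2,1,3) order_refl wt(4) local'[OF t]]) (use t in simp)
      qed
      then have "\<forall>x\<in>?T. \<forall>y\<in>?T. P x \<longrightarrow> P y" by blast
      moreover have "openin (top_of_set {0..1}) ?T" "t0 \<in> ?T" using t0 e(1) by auto
      ultimately show "\<exists>T. openin (top_of_set {0..1}) T \<and> t0 \<in> T \<and> (\<forall>x\<in>T. \<forall>y\<in>T. P x \<longrightarrow> P y)" by blast
    qed (use \<open>P 0\<close> in auto)
    then have "homotopic_paths realization (p \<circ> linepath 0 1) (g u +++ fun_segment (vertex u) b)"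
      using u unfolding P_def p1 by blast
    also have "homotopic_paths realization \<dots> (\<lambda>t. b)" by (rule const)
    finally show ?thesis by (simp add: o_def linepath_def)
  qed
  then show "trivial_group (fundamental_group realization b)"
    by (simp add: trivial_fundamental_group_iff[OF b])
qed

text \<open>The function \<open>f\<close> crushes everything outside the open edge to the point 1
  and wraps the edge once around the circle. The test loop runs along the edge and returns through
  the apex, where \<open>f\<close> is constant.\<close>

lemma not_simply_conn_realization:
  assumes F: "{s, t} \<in> facets" and st: "s \<noteq> t"
  shows "\<not> simply_conn realization"
proof
  assume "simply_conn realization"
  have FK: "{s, t} \<in> K" using F by (rule facet_face)
  have as: "{a, s} \<in> K" and at: "{a, t} \<in> K"
    using facet_cone_proper[OF F, of "{s}"] facet_cone_proper[OF F, of "{t}"] st by auto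
  have sa: "s \<noteq> a" "t \<noteq> a" using apex_notin_facet[OF F] by auto
  define f where "f x = (if x s + x t = 1 then exp (2 * of_real pi * \<i> * of_real (x t)) else 1 :: complex)" for x :: "'a \<Rightarrow> real"
  \<comment> \<open>The closed edge and the complement of the open edge. They cover the realization
    because the edge is maximal, and meet only in its ends, where the exponential is 1; hence
    \<open>f\<close> is continuous by pasting.\<close>
  define A where "A = realization \<inter> {x. x s + x t = 1}"
  define B where "B = realization \<inter> {x. min (x s) (x t) = 0}"
  have AB: "A \<union> B = realization"
  proof -
    have "x s + x t = 1 \<or> min (x s) (x t) = 0" if x: "x \<in> realization" for x
    proof (cases "min (x s) (x t) = 0")
      case False
      then have "x s \<noteq> 0" "x t \<noteq> 0" using realizationD(1)[OF x, of s] realizationD(1)[OF x, of t] by auto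
      then have "{s, t} \<subseteq> vsupp x" by simp
      then have "vsupp x = {s, t}" by (rule facet_maximal[OF F realizationD(2)[OF x]])
      then have "sum x {s, t} = 1" by (intro realizationD(3)[OF x]) auto
      then show ?thesis using st by simp
    qed simp
    then show ?thesis by (auto simp: A_def B_def)
  qed
  have cont: "continuous_on realization f"
    unfolding AB[symmetric] f_def
  proof (rule continuous_on_cases_local)
    show "closedin (top_of_set (A \<union> B)) A" "closedin (top_of_set (A \<union> B)) B"
      unfolding AB unfolding A_def B_def
      by (intro closedin_closed_Int closed_Collect_eq continuous_intros)+
    show "continuous_on A (\<lambda>x. exp (2 * of_real pi * \<i> * of_real (x t)) :: complex)"
      by (intro continuous_intros)
    fix x assume "x \<in> A \<and> \<not> x s + x t = 1 \<or> x \<in> B \<and> x s + x t = 1"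
    then have "x t = 0 \<or> x t = 1" by (auto simp: A_def B_def min_def split: if_splits)
    then show "exp (2 * of_real pi * \<i> * of_real (x t)) = (1 :: complex)" by auto
  qed simp
  define l where "l = fun_segment (vertex a) (vertex s) +++ (fun_segment (vertex s) (vertex t) +++ fun_segment (vertex t) (vertex a))"
  have va: "vertex a \<in> realization" by (rule vertex_realization[OF apex])
  have sub: "path_image (fun_segment (vertex v) (vertex w)) \<subseteq> realization"
    if "S \<in> K" "v \<in> S" "w \<in> S" for v w S
    using path_image_fun_segment[OF that(1) vertex_in_cell[OF that(1,2)] vertex_in_cell[OF that(1,3)]]
      cell_subset by blast
  have "path_image l \<subseteq> realization"
    unfolding l_def by (intro subset_path_image_join sub[OF as] sub[OF FK] sub[OF at]) auto
  then have "l \<in> based_loops realization (vertex a)"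
    by (simp add: l_def based_loops_def path_join_imp)
  then have "homotopic_paths realization l (\<lambda>t. vertex a)"
    using \<open>simply_conn realization\<close> va trivial_fundamental_group_iff[OF va]
    unfolding simply_conn_def by blast
  then have "homotopic_paths (- {0}) (f \<circ> l) (f \<circ> (\<lambda>t. vertex a))"
    by (rule homotopic_paths_continuous_image[OF _ cont]) (auto simp: f_def)
  then have "winding_number (f \<circ> l) 0 = winding_number (f \<circ> (\<lambda>t. vertex a)) 0"
    by (rule winding_number_homotopic_paths)
  moreover have "winding_number (f \<circ> (\<lambda>t. vertex a)) 0 = 0"
    by (simp add: o_def winding_number_zero_const f_def)
  moreover have "winding_number (f \<circ> l) 0 = 1"
  proof -
    have s1: "f \<circ> fun_segment (vertex a) (vertex s) = (\<lambda>_. 1)"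
      using sa st by (auto simp: fun_eq_iff f_def fun_segment_def)
    have s3: "f \<circ> fun_segment (vertex t) (vertex a) = (\<lambda>_. 1)"
      using sa st by (auto simp: fun_eq_iff f_def fun_segment_def)
    have s2: "f \<circ> fun_segment (vertex s) (vertex t) = exp \<circ> linepath 0 (2 * of_real pi * \<i>)"
      using st by (auto simp: fun_eq_iff f_def fun_segment_def linepath_def scaleR_conv_of_real mult_ac)
    have w2: "winding_number (exp \<circ> linepath 0 (2 * of_real pi * \<i>)) 0 = 1"
      by (subst winding_number_compose_exp) auto
    have c: "path (\<lambda>_. 1 :: complex)" "0 \<notin> path_image (\<lambda>_. 1 :: complex)"
      "pathstart (\<lambda>_. 1 :: complex) = 1" "pathfinish (\<lambda>_. 1 :: complex) = 1"
      by (auto simp: path_def path_image_def pathstart_def pathfinish_def)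
    have e: "path (exp \<circ> linepath 0 (2 * of_real pi * \<i>))" "0 \<notin> path_image (exp \<circ> linepath 0 (2 * of_real pi * \<i>))"
      "pathstart (exp \<circ> linepath 0 (2 * of_real pi * \<i>)) = 1" "pathfinish (exp \<circ> linepath 0 (2 * of_real pi * \<i>)) = 1"
      by (auto simp: path_image_compose pathstart_compose pathfinish_compose intro!: path_continuous_image continuous_intros)
    have w1: "winding_number (\<lambda>_. 1) 0 = 0" by (simp add: winding_number_zero_const)
    show ?thesis
      unfolding l_def path_compose_join s1 s2 s3
      by (subst winding_number_join; (subst winding_number_join)?)
         (use c e w1 w2 in \<open>auto intro!: path_join_imp simp: path_image_join\<close>)
  qed
  ultimately show False by simp
qed

end

section \<open>Complexes of sets with bounded sum\<close>

text \<open>\<open>0 \<notin> A\<close> serves twice: 1 becomes the least vertex, as the signs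
  require, and every other vertex is at least 2, as \<open>cone_proper\<close> requires. The bound
  on \<open>q\<close> makes the apex a face.\<close>

lemma cone_bounded_sum_complex:
  assumes A: "1 \<in> A" "0 \<notin> A" and q: "2 \<le> q"
  shows "least_cone_with_facets (bounded_sum_complex A q) 1"
proof -
  let ?K = "bounded_sum_complex A q"
  have mem: "F \<in> ?K \<longleftrightarrow> finite F \<and> F \<noteq> {} \<and> F \<subseteq> A \<and> \<Sum>F < q" for F
    by (simp add: bounded_sum_complex_def)
  show ?thesis
  proof
    have "F \<subseteq> {..<q}" if F: "F \<in> ?K" for F
    proof
      fix v assume "v \<in> F"
      then have "v \<le> \<Sum>F" using F by (intro member_le_sum) (auto simp: mem)
      then show "v \<in> {..<q}" using F by (simp add: mem)
    qed
    then show "finite ?K"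
      by (meson PowI finite_Pow_iff finite_lessThan finite_subset subsetI)
    show "finite F" "F \<noteq> {}" if "F \<in> ?K" for F using that by (simp_all add: mem)
    show "G \<in> ?K" if "F \<in> ?K" "G \<subseteq> F" "G \<noteq> {}" for F G
      using that sum_mono2[of F G "\<lambda>v. v"] by (auto simp: mem intro: finite_subset)
    show "{1} \<in> ?K" using A q by (simp add: mem)
    show "insert 1 G \<in> ?K" if F: "F \<in> ?K" "insert 1 F \<notin> ?K" and G: "G \<subset> F" "G \<noteq> {}" for F G
    proof -
      have fin: "finite F" "finite G" using F G by (auto simp: mem intro: finite_subset)
      have "1 \<notin> F" using F by (auto simp: insert_absorb)
      obtain v where v: "v \<in> F" "v \<notin> G" using G by blast
      then have "2 \<le> v" using F A \<open>1 \<notin> F\<close> by (cases "v = 0"; cases "v = 1") (auto simp: mem)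
      have "\<Sum>(insert v G) \<le> \<Sum>F" using fin v G by (intro sum_mono2) auto
      then have "v + \<Sum>G \<le> \<Sum>F" using fin v by simp
      moreover have "\<Sum>(insert 1 G) \<le> 1 + \<Sum>G" using fin by (cases "1 \<in> G") (simp_all add: insert_absorb)
      ultimately have "\<Sum>(insert 1 G) < q" using F \<open>2 \<le> v\<close> by (auto simp: mem)
      then show ?thesis using F G fin A by (auto simp: mem)
    qed
    show "1 \<le> v" if "F \<in> ?K" "v \<in> F" for F v
      using that A by (cases "v = 0") (auto simp: mem)
  qed
qed

lemma facets_bounded_sum_complex:
  assumes A: "1 \<in> A" "0 \<notin> A" and q: "2 \<le> q"
  shows "F \<in> cone_with_facets.facets (bounded_sum_complex A q) 1 \<longleftrightarrow>
     finite F \<and> F \<noteq> {} \<and> F \<subseteq> {s \<in> A. s > 1} \<and> \<Sum>F = q - 1"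
proof -
  interpret least_cone_with_facets "bounded_sum_complex A q" 1
    by (rule cone_bounded_sum_complex[OF assms])
  have "1 < v" if "v \<in> A" "v \<noteq> 1" for v using that A by (cases "v = 0") auto
  then have gt1: "F \<subseteq> {s \<in> A. s > 1} \<longleftrightarrow> F \<subseteq> A \<and> 1 \<notin> F" by blast
  show ?thesis
    unfolding gt1 facets_def
    using q A by (cases "1 \<in> F") (auto simp: bounded_sum_complex_def insert_absorb)
qed

lemma dim_reduced_homology_bounded_sum_complex:
  assumes A: "1 \<in> A" "0 \<notin> A" and q: "2 \<le> q"
  shows "dim_reduced_homology (bounded_sum_complex A q) j = card (distinct_sum_reps {s \<in> A. s > 1} (j + 1) (q - 1))"
proof -
  interpret least_cone_with_facets "bounded_sum_complex A q" 1
    by (rule cone_bounded_sum_complex[OF assms])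
  have "{F \<in> facets. card F = Suc j} = distinct_sum_reps {s \<in> A. s > 1} (j + 1) (q - 1)"
    unfolding distinct_sum_reps_def facets_bounded_sum_complex[OF assms] by (intro Collect_cong) auto
  then show ?thesis by (simp add: dim_reduced_homology_eq)
qed

lemma bouquet_bounded_sum_complex:
  assumes A: "1 \<in> A" "0 \<notin> A" and q: "2 \<le> q"
  shows "\<exists>(I :: nat set) d.
    top_of_set (geom_realization (bounded_sum_complex A q)) homotopy_equivalent_space sphere_bouquet I d"
proof -
  interpret least_cone_with_facets "bounded_sum_complex A q" 1
    by (rule cone_bounded_sum_complex[OF assms])
  obtain \<phi> where "bij_betw \<phi> {0..<card facets} facets"
    using ex_bij_betw_nat_finite[OF finite_facets] by blast
  then show ?thesis using realization_homotopy_equivalent_bouquet by blast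
qed

lemma connected_bounded_sum_complex_iff:
  assumes A: "1 \<in> A" "0 \<notin> A" and q: "3 \<le> q"
  shows "connected (geom_realization (bounded_sum_complex A q)) \<longleftrightarrow> q - 1 \<notin> A"
    and "simply_conn (geom_realization (bounded_sum_complex A q)) \<longleftrightarrow>
      q - 1 \<notin> A \<and> \<not> (\<exists>s t. s \<in> A \<and> t \<in> A \<and> s > 1 \<and> t > 1 \<and> s \<noteq> t \<and> s + t = q - 1)"
proof -
  have q2: "2 \<le> q" using q by simp
  interpret least_cone_with_facets "bounded_sum_complex A q" 1
    by (rule cone_bounded_sum_complex[OF A q2])
  note facets_iff = facets_bounded_sum_complex[OF A q2]
  \<comment> \<open>This is where \<open>q \<ge> 3\<close> enters: for \<open>q = 2\<close> the
    number \<open>q - 1\<close> is the apex, which is no facet.\<close>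
  have single: "{q - 1} \<in> facets \<longleftrightarrow> q - 1 \<in> A"
    unfolding facets_iff using q by auto
  have card_0: "card F \<noteq> 0" if "F \<in> facets" for F using that unfolding facets_iff by simp
  have card_1: "card F \<noteq> 1" if "F \<in> facets" "q - 1 \<notin> A" for F
  proof
    assume "card F = 1"
    then obtain s where "F = {s}" by (rule card_1_singletonE)
    then show False using that unfolding facets_iff by auto
  qed
  have conn: "connected realization" if "q - 1 \<notin> A"
  proof (rule path_connected_imp_connected, rule path_connected_realization)
    show "2 \<le> card F" if "F \<in> facets" for F
      using card_0[OF that] card_1[OF that \<open>q - 1 \<notin> A\<close>] by linarith
  qed
  then show conn_iff: "connected realization \<longleftrightarrow> q - 1 \<notin> A"
    using not_connected_realization[of "q - 1"] single by blast
  show "simply_conn realization \<longleftrightarrow>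
      q - 1 \<notin> A \<and> \<not> (\<exists>s t. s \<in> A \<and> t \<in> A \<and> s > 1 \<and> t > 1 \<and> s \<noteq> t \<and> s + t = q - 1)" (is "_ \<longleftrightarrow> _ \<and> \<not> ?pair")
  proof (intro iffI conjI notI)
    assume sc: "simply_conn realization"
    show False if "q - 1 \<in> A"
      using sc conn_iff path_connected_imp_connected that unfolding simply_conn_def by blast
    assume ?pair
    then obtain s t where st: "s \<in> A" "t \<in> A" "s > 1" "t > 1" "s \<noteq> t" "s + t = q - 1" by blast
    then have "{s, t} \<in> facets" unfolding facets_iff by simp
    then show False using not_simply_conn_realization sc st(5) by blast
  next
    assume h: "q - 1 \<notin> A \<and> \<not> ?pair"
    have card_2: "card F \<noteq> 2" if "F \<in> facets" for F
    proof
      assume "card F = 2"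
      then obtain s t where st: "F = {s, t}" "s \<noteq> t" by (auto simp: card_2_iff)
      then have "s \<in> A" "t \<in> A" "s > 1" "t > 1" "s + t = q - 1"
        using that unfolding facets_iff by simp_all
      then show False using h st(2) by blast
    qed
    show "simply_conn realization"
    proof (rule simply_conn_realization)
      show "3 \<le> card F" if "F \<in> facets" for F
        using card_0[OF that] card_1[OF that] card_2[OF that] h by linarith
    qed
  qed
qed

lemma one_in_pos_powers: "1 \<in> pos_powers k"
  unfolding pos_powers_def by (intro CollectI exI[of _ 1]) simp

lemma zero_notin_pos_powers: "0 \<notin> pos_powers k"
  by (auto simp: pos_powers_def)

theorem theorem1p6:
  fixes q :: nat
  assumes "q \<ge> 2"
  shows "(\<exists>(I :: nat set) d.
            top_of_set (geom_realization (Square q)) homotopy_equivalent_space sphere_bouquet I d) \<and>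
         (\<forall>j. dim_reduced_homology (Square q) j =
              card (distinct_sum_reps {s \<in> pos_squares. s > 1} (j + 1) (q - 1))) \<and>
         (q \<ge> 3 \<longrightarrow>
            (connected (geom_realization (Square q)) \<longleftrightarrow> q - 1 \<notin> pos_squares) \<and>
            (simply_conn (geom_realization (Square q)) \<longleftrightarrow>
               q - 1 \<notin> pos_squares \<and>
               \<not> (\<exists>s t. s \<in> pos_squares \<and> t \<in> pos_squares \<and> s > 1 \<and> t > 1 \<and> s \<noteq> t \<and> s + t = q - 1))) \<and>
         (\<forall>j. dim_reduced_homology (Cube q) j =
              card (distinct_sum_reps {s \<in> pos_cubes. s > 1} (j + 1) (q - 1)))"
proof -
  note sq = one_in_pos_powers[of 2] zero_notin_pos_powers[of 2]
  note cu = one_in_pos_powers[of 3] zero_notin_pos_powers[of 3]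
  show ?thesis
    unfolding Square_def Cube_def
    using bouquet_bounded_sum_complex[OF sq assms] dim_reduced_homology_bounded_sum_complex[OF sq assms]
      connected_bounded_sum_complex_iff[OF sq] dim_reduced_homology_bounded_sum_complex[OF cu assms]
    by blast
qed

end
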